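(* There exists a continuous linear operator $T\colon s^{\mathbb{N}}\to s^{\mathbb{N}}$ which has no non-trivial invariant subspaces, i.e. there is no closed linear subspace $H$ with $\{0\}\subsetneq H\subsetneq s^{\mathbb{N}}$ and $T(H)\subset H$.
   Context: $\mathbb{N}=\{0,1,2,\dots\}$; scalars are real or complex. $s$ is the space of rapidly decreasing sequences: all scalar sequences $x=(x_j)_{j=0}^\infty$ with $p_N(x)=\sum_{j=0}^\infty |x_j|(j+1)^N<\infty$ for every $N\in\mathbb{N}$, with the (Fréchet) topology generated by the seminorms $p_N$, $N\in\mathbb{N}$. $s^{\mathbb{N}}$ is the countable product of copies of $s$ with the product topology; it is a Fréchet space. *)

theory Defs
  imports "HOL-Analysis.Analysis" "HOL-Library.Function_Algebras"
begin

text \<open>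
  The class \<^class>\<open>real_normed_field\<close> serves to treat real and complex scalars uniformly.
\<close>

typedef (overloaded) 'a rapid_seq =
  "{x :: nat \<Rightarrow> 'a :: real_normed_field. \<forall>N. summable (\<lambda>j. norm (x j) * real (j + 1) ^ N)}"
  morphisms seq_nth Abs_rapid_seq
  by (rule exI[of _ "\<lambda>_. 0"]) simp

setup_lifting type_definition_rapid_seq

lemma rapid_summable_scale:
  fixes x :: "nat \<Rightarrow> 'a :: real_normed_field"
  assumes "summable (\<lambda>j. norm (x j) * real (j + 1) ^ N)"
  shows "summable (\<lambda>j. norm (c * x j) * real (j + 1) ^ N)"
  using summable_mult[OF assms, of "norm c"] by (simp add: norm_mult mult.assoc)

lemma rapid_summable_add:
  fixes x y :: "nat \<Rightarrow> 'a :: real_normed_field"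
  assumes "summable (\<lambda>j. norm (x j) * real (j + 1) ^ N)"
    and "summable (\<lambda>j. norm (y j) * real (j + 1) ^ N)"
  shows "summable (\<lambda>j. norm (x j + y j) * real (j + 1) ^ N)"
proof (rule summable_comparison_test')
  show "summable (\<lambda>j. norm (x j) * real (j + 1) ^ N + norm (y j) * real (j + 1) ^ N)"
    using assms by (rule summable_add)
  fix j :: nat
  have "norm (x j + y j) * real (j + 1) ^ N \<le> (norm (x j) + norm (y j)) * real (j + 1) ^ N"
    by (intro mult_right_mono norm_triangle_ineq) simp
  then show "norm (norm (x j + y j) * real (j + 1) ^ N)
      \<le> norm (x j) * real (j + 1) ^ N + norm (y j) * real (j + 1) ^ N"
    by (simp add: norm_mult norm_power distrib_right)
qed

instantiation rapid_seq :: (real_normed_field) ab_group_add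
begin

lift_definition zero_rapid_seq :: "'a rapid_seq" is "\<lambda>_. 0"
  by simp

lift_definition plus_rapid_seq :: "'a rapid_seq \<Rightarrow> 'a rapid_seq \<Rightarrow> 'a rapid_seq"
  is "\<lambda>x y j. x j + y j"
  by (blast intro: rapid_summable_add)

lift_definition uminus_rapid_seq :: "'a rapid_seq \<Rightarrow> 'a rapid_seq"
  is "\<lambda>x j. - x j"
  by simp

definition minus_rapid_seq :: "'a rapid_seq \<Rightarrow> 'a rapid_seq \<Rightarrow> 'a rapid_seq"
  where "minus_rapid_seq x y = x + - y"

instance
  by standard (simp_all add: minus_rapid_seq_def, (transfer, simp add: algebra_simps fun_eq_iff)+)

end

lift_definition scale_rapid_seq ::
  "'a :: real_normed_field \<Rightarrow> 'a rapid_seq \<Rightarrow> 'a rapid_seq"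
  is "\<lambda>c x j. c * x j"
  by (blast intro: rapid_summable_scale)

definition rapid_seminorm :: "nat \<Rightarrow> 'a :: real_normed_field rapid_seq \<Rightarrow> real"
  where "rapid_seminorm N x = (\<Sum>j. norm (seq_nth x j) * real (j + 1) ^ N)"

instantiation rapid_seq :: (real_normed_field) topological_space
begin

definition open_rapid_seq :: "'a rapid_seq set \<Rightarrow> bool"
  where "open_rapid_seq =
    generate_topology {{y. rapid_seminorm N (y - x) < e} | x N e. 0 < e}"

instance
  by standard
    (simp_all add: open_rapid_seq_def generate_topology.UNIV generate_topology.Int
      generate_topology.UN)

end

text \<open>
  The space \<open>s\<^sup>\<nat>\<close> is the type \<^typ>\<open>nat \<Rightarrow> 'a rapid_seq\<close>: its topology is the product topology
  provided by the library for function types, its group structure is the pointwise one of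
  \<^theory>\<open>HOL-Library.Function_Algebras\<close>.
\<close>

definition scale_rapid_seq_prod ::
  "'a :: real_normed_field \<Rightarrow> (nat \<Rightarrow> 'a rapid_seq) \<Rightarrow> nat \<Rightarrow> 'a rapid_seq"
  where "scale_rapid_seq_prod c x = (\<lambda>k. scale_rapid_seq c (x k))"

interpretation rapid_seq: vector_space scale_rapid_seq
  by standard (transfer; simp add: algebra_simps fun_eq_iff)+

interpretation rapid_seq_prod: vector_space scale_rapid_seq_prod
  by standard (simp_all add: scale_rapid_seq_prod_def fun_eq_iff
      rapid_seq.scale_right_distrib rapid_seq.scale_left_distrib)

definition has_no_nontrivial_invariant_subspace ::
  "((nat \<Rightarrow> 'a :: real_normed_field rapid_seq) \<Rightarrow> (nat \<Rightarrow> 'a rapid_seq)) \<Rightarrow> bool"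
  where "has_no_nontrivial_invariant_subspace T \<longleftrightarrow>
    \<not> (\<exists>H. closed H \<and> module.subspace scale_rapid_seq_prod H \<and> {0} \<subset> H \<and> H \<subset> UNIV \<and> T ` H \<subseteq> H)"

end

theory Submission
  imports Defs
begin

text \<open>
  The operator is multiplication by \<open>z\<close> on polynomials, completed for a suitable sequence of
  seminorms. The space \<open>s\<^sup>\<nat>\<close> has a basis \<open>e\<^sub>l\<close> (\<open>l \<in> \<nat>\<close>), where \<open>e\<^sub>l\<close> belongs to the copy of \<open>s\<close> with
  number \<open>row l\<close> and the \<open>N\<close>-th seminorm is a weighted \<open>\<ell>\<^sup>1\<close>-norm that does not see the rows above \<open>N\<close>.
  The absence of a continuous norm is what makes the construction short: the rows above \<open>N\<close> can be used
  freely without the \<open>N\<close>-th seminorm noticing.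

  The operator \<open>T\<close> is determined by the orbit \<open>z\<^sup>k = T\<^sup>k e\<^sub>0\<close>. The indices are divided into stages. In
  stage \<open>n\<close>, with a number \<open>C\<close> called its period, \<open>z\<^sup>k = e\<^sub>k\<close> for the early \<open>k\<close>, and
  \<open>z\<^sup>k = e\<^sub>k + z\<^bsup>k-C\<^esup>\<close> for the later ones, which form the blocks \<open>rC \<le> k < (r+1)C\<close> with
  \<open>r = 1, \<dots>, n+1\<close>; block \<open>r\<close> lies in row \<open>n+1-r\<close>. Thus, up to vectors in high rows,
  \<open>T\<^sup>C\<close> acts as the identity on the span of the first \<open>e\<^sub>l\<close>.
  Rows drop slowly along the basis, and the vectors of stage \<open>n\<close>, except for the first, have weights
  that are huge compared with everything earlier, which makes \<open>T\<close> continuous (\<open>shift_op_bound\<close>): the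
  steps of \<open>T\<close> that produce much earlier vectors start in row \<open>0\<close>.

  As \<open>e\<^sub>0\<close> is a cyclic vector, it suffices to approximate \<open>e\<^sub>0\<close> by \<open>G(T) x\<close> for every \<open>x \<noteq> 0\<close>. Let \<open>M\<close> be
  given, let stage \<open>m\<close> be late, and let \<open>y\<close> be the part of \<open>x\<close> on the indices up to the end of stage \<open>m\<close>,
  written as a polynomial \<open>h\<close> in \<open>z\<close>.
  If all terms of \<open>h\<close> had degree at least \<open>(m-M)C\<close>, the coefficients of \<open>y\<close> in the block
  of row \<open>M+1\<close> would determine its coefficients below \<open>C\<close>; since weights in the block are much larger,
  the tail of \<open>x\<close> would dominate its head (\<open>head_le_tail\<close>), which is false for late \<open>m\<close>. So \<open>h\<close> has
  a term of lower degree, and some \<open>p\<close> without constant term makes \<open>p h\<close> the monomial of degree \<open>(m-M)C\<close>,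
  up to terms of high degree; this monomial is \<open>e\<^sub>0\<close> up to rows above \<open>M\<close> (\<open>exact_solution\<close>).
  By compactness finitely many \<open>p\<close> suffice for all such \<open>y\<close>, even though the coordinates of \<open>y\<close>
  in high rows are not bounded (\<open>uniformly_solvable_exists\<close>). This yields a bound on the coefficients of
  \<open>p\<close> which depends only on the weights of the stages up to \<open>m\<close>, so the
  weights of stage \<open>m+1\<close> can be chosen far beyond it (\<open>weights_exist\<close>).
  Finally let \<open>G(T) = p(T) T\<^sup>C\<close> with the period \<open>C\<close> of stage \<open>m+1\<close>. On \<open>y\<close> the power \<open>T\<^sup>C\<close> makes no
  visible difference, and the terms of high degree are invisible (\<open>poly_at_orbit_comb\<close>). On the
  remaining part of \<open>x\<close> the powers of \<open>T\<close> in \<open>G(T)\<close> gain a factor that outweighs the coefficients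
  of \<open>p\<close> (\<open>iterate_tail_bound\<close>).
\<close>

section \<open>Stages, orbits and rows\<close>

text \<open>
  Stage \<open>n\<close> consists of the indices from \<open>start n\<close> on. The first factor \<open>n + 2\<close> leaves room for one
  interval of length \<open>start n + 1\<close> in each of the rows \<open>n, \<dots>, 0\<close> before the period is over, the second
  one for one block of the length of a period in each of these rows.
\<close>

primrec start :: "nat \<Rightarrow> nat" where
  "start 0 = 0"
| "start (Suc n) = (n + 2) * ((n + 2) * Suc (start n))"

definition period :: "nat \<Rightarrow> nat" where
  "period n = (n + 2) * Suc (start n)"

lemma start_Suc: "start (Suc n) = (n + 2) * period n"
  by (simp add: period_def)

declare start.simps(2) [simp del]

lemma period_ge: "2 * Suc (start n) \<le> period n"
  by (simp add: period_def)

lemma period_pos [simp]: "0 < period n"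
  by (simp add: period_def)

lemma start_Suc_ge: "2 * period n \<le> start (Suc n)"
  by (simp add: start_Suc)

lemma period_less_start: "period n < start (Suc n)"
  using start_Suc_ge[of n] period_pos[of n] by linarith

lemma start_less_period: "start n < period n"
  using period_ge[of n] by simp

lemma start_less_Suc: "start n < start (Suc n)"
  using start_less_period period_less_start less_trans by blast

lemma strict_mono_start: "strict_mono start"
  by (simp add: strict_mono_Suc_iff start_less_Suc)

lemma start_mono: "m \<le> n \<Longrightarrow> start m \<le> start n"
  using strict_mono_start by (simp add: strict_mono_less_eq)

lemma start_ge: "n \<le> start n"
  using strict_mono_start by (rule strict_mono_imp_increasing)

definition stage :: "nat \<Rightarrow> nat" where
  "stage l = (LEAST n. l < start (Suc n))"

lemma stage_upper: "l < start (Suc (stage l))"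
  unfolding stage_def
proof (rule LeastI)
  show "l < start (Suc l)"
    using start_ge[of "Suc l"] by simp
qed

lemma stage_lower: "start (stage l) \<le> l"
proof (cases "stage l")
  case (Suc m)
  then have "\<not> l < start (Suc m)"
    unfolding stage_def by (intro not_less_Least) simp
  with Suc show ?thesis by simp
qed simp

lemma stage_eqI:
  assumes "start n \<le> l" "l < start (Suc n)"
  shows "stage l = n"
proof -
  have "start (stage l) < start (Suc n)" "start n < start (Suc (stage l))"
    using assms stage_lower[of l] stage_upper[of l] by linarith+
  then have "stage l < Suc n" "n < Suc (stage l)"
    using strict_mono_start by (simp_all add: strict_mono_less)
  then show ?thesis by simp
qed

lemma stage_start [simp]: "stage (start n) = n"
  by (rule stage_eqI) (auto simp: start_less_Suc)

text \<open>
  Indices \<open>k\<close> whose orbit vector is \<open>e\<^sub>k\<close> plus the orbit vector one period earlier.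
\<close>

definition linked :: "nat \<Rightarrow> bool" where
  "linked l \<longleftrightarrow> period (stage l) \<le> l"

lemma linkedI:
  assumes "period n \<le> l" "l < start (Suc n)"
  shows "linked l" "stage l = n"
proof -
  show "stage l = n"
    using assms start_less_period[of n] by (intro stage_eqI) auto
  then show "linked l"
    using assms by (simp add: linked_def)
qed

lemma not_linkedI:
  assumes "start n \<le> l" "l < period n"
  shows "\<not> linked l" "stage l = n"
proof -
  show "stage l = n"
    using assms period_less_start[of n] by (intro stage_eqI) auto
  then show "\<not> linked l"
    using assms by (simp add: linked_def)
qed

text \<open>
  All coordinates of the orbit vectors \<open>T\<^sup>k e\<^sub>0\<close> are \<open>0\<close> or \<open>1\<close>, so a set describes them.
\<close>

function orbit_support :: "nat \<Rightarrow> nat set" where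
  "orbit_support k = insert k (if linked k then orbit_support (k - period (stage k)) else {})"
  by pat_completeness auto
termination
proof (relation "Wellfounded.measure id")
  fix k assume "linked k"
  then show "(k - period (stage k), k) \<in> Wellfounded.measure id"
    using period_pos[of "stage k"] by (simp add: linked_def del: period_pos) 
qed simp

declare orbit_support.simps [simp del]

lemma orbit_support_le: "i \<in> orbit_support k \<Longrightarrow> i \<le> k"
proof (induction k arbitrary: i rule: orbit_support.induct)
  case (1 k)
  then show ?case
    by (subst (asm) (2) orbit_support.simps) (force split: if_splits dest!: 1(1))
qed

lemma finite_orbit_support [simp]: "finite (orbit_support k)"
  by (rule finite_subset[of _ "{..k}"]) (auto dest: orbit_support_le)

lemma self_in_orbit_support [simp]: "k \<in> orbit_support k"
  by (subst orbit_support.simps) simp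

lemma orbit_support_unlinked:
  "start n \<le> k \<Longrightarrow> k < period n \<Longrightarrow> orbit_support k = {k}"
  by (subst orbit_support.simps) (simp add: not_linkedI)

lemma orbit_support_linked:
  "period n \<le> k \<Longrightarrow> k < start (Suc n) \<Longrightarrow> orbit_support k = insert k (orbit_support (k - period n))"
  by (subst orbit_support.simps) (simp add: linkedI)

lemma orbit_support_block:
  assumes "r * period n + i < start (Suc n)" "i < period n"
  shows "orbit_support (r * period n + i) = orbit_support i \<union> (\<lambda>q. q * period n + i) ` {1..r}"
  using assms(1)
proof (induction r)
  case (Suc r)
  have "orbit_support (Suc r * period n + i) = insert (Suc r * period n + i) (orbit_support (Suc r * period n + i - period n))"
    using Suc.prems by (intro orbit_support_linked) auto
  also have "Suc r * period n + i - period n = r * period n + i"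
    by simp
  also have "orbit_support \<dots> = orbit_support i \<union> (\<lambda>q. q * period n + i) ` {1..r}"
    using Suc by simp
  also have "insert (Suc r * period n + i) (orbit_support i \<union> (\<lambda>q. q * period n + i) ` {1..r}) =
      orbit_support i \<union> (\<lambda>q. q * period n + i) ` {1..Suc r}"
    by (auto simp: atLeastAtMostSuc_conv)
  finally show ?case .
qed simp

text \<open>
  Under a small shift of the index the row drops by at most one within the unlinked part of a stage,
  and a shift by less than two periods costs at most two rows within the linked part. This is what
  lets the iterates of the operator lose only two seminorms. The first index of a stage is exceptional:
  running through all pairs, it fills the places of \<open>s\<^sup>\<nat>\<close> with small column number.
\<close>

definition row :: "nat \<Rightarrow> nat" where
  "row l = (let n = stage l in
     if l = start n then fst (prod_decode n)
     else if l < period n then Suc n - l div Suc (start n)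
     else Suc n - l div period n)"

lemma fst_prod_decode_le: "fst (prod_decode n) \<le> n"
  by (metis le_prod_encode_1 prod.collapse prod_decode_inverse)

lemma snd_prod_decode_le: "snd (prod_decode n) \<le> n"
  by (metis le_prod_encode_2 prod.collapse prod_decode_inverse)

lemma row_start: "row (start n) = fst (prod_decode n)"
  by (simp add: row_def)

lemma row_unlinked:
  "start n < l \<Longrightarrow> l < period n \<Longrightarrow> row l = Suc n - l div Suc (start n)"
  using not_linkedI[of n l] by (simp add: row_def)

lemma row_linked:
  "period n \<le> l \<Longrightarrow> l < start (Suc n) \<Longrightarrow> row l = Suc n - l div period n"
  using linkedI[of n l] start_less_period[of n] by (simp add: row_def)

lemma row_le_stage: "row l \<le> stage l"
proof -
  define n where "n = stage l"
  have n: "start n \<le> l" "l < start (Suc n)"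
    using stage_lower stage_upper by (auto simp: n_def)
  consider "l = start n" | "start n < l" "l < period n" | "period n \<le> l"
    using n by linarith
  then show ?thesis
  proof cases
    case 1
    then show ?thesis by (simp add: row_start fst_prod_decode_le)
  next
    case 2
    then have "0 < l div Suc (start n)"
      by (simp add: div_greater_zero_iff)
    then show ?thesis
      using 2 by (simp add: row_unlinked n_def[symmetric])
  next
    case 3
    then have "0 < l div period n"
      by (simp add: div_greater_zero_iff)
    then show ?thesis
      using 3 n by (simp add: row_linked n_def[symmetric])
  qed
qed

lemma row_first:
  assumes "start n < l" "l < 2 * Suc (start n)"
  shows "row l = n"
proof -
  have "l div Suc (start n) = 1"
    using assms by (intro div_nat_eqI) auto
  moreover have "l < period n"
    using assms period_ge[of n] by linarith
  ultimately show ?thesis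
    using assms by (simp add: row_unlinked)
qed

lemma row_block:
  assumes "1 \<le> r" "r \<le> Suc n" "i < period n"
  shows "row (r * period n + i) = Suc n - r"
proof -
  have "r * period n + i < Suc r * period n"
    using assms by simp
  also have "Suc r * period n \<le> start (Suc n)"
    using assms unfolding start_Suc by (intro mult_right_mono) auto
  finally have "r * period n + i < start (Suc n)" .
  moreover have "period n \<le> r * period n + i"
    using assms by (simp add: trans_le_add1)
  ultimately show ?thesis
    using assms by (simp add: row_linked)
qed

section \<open>Weights\<close>


text \<open>
  The number \<open>base - 1\<close> plays the role of a column number. It is even at the first index of a stage,
  where all even columns are used up one after the other, and odd at the other indices, where it may be
  as large as needed.
\<close>

definition base :: "(nat \<Rightarrow> nat) \<Rightarrow> nat \<Rightarrow> nat" where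
  "base \<beta> l = (let n = stage l in
     if l = start n then 2 * snd (prod_decode n) + 1 else 2 * ((\<beta> n)\<^sup>2 + l) + 2)"

definition weight :: "(nat \<Rightarrow> nat) \<Rightarrow> nat \<Rightarrow> nat \<Rightarrow> nat" where
  "weight \<beta> N l = (if row l \<le> N then base \<beta> l ^ N else 0)"

definition orbit_weight :: "(nat \<Rightarrow> nat) \<Rightarrow> nat \<Rightarrow> nat \<Rightarrow> nat" where
  "orbit_weight \<beta> N k = (\<Sum>i\<in>orbit_support k. weight \<beta> N i)"

lemma base_pos: "1 \<le> base \<beta> l"
  by (simp add: base_def Let_def)

lemma base_cong:
  "\<lbrakk>\<And>k. k < n \<Longrightarrow> \<beta> k = \<beta>' k; l \<le> start n\<rbrakk> \<Longrightarrow> base \<beta> l = base \<beta>' l"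
proof -
  assume *: "\<And>k. k < n \<Longrightarrow> \<beta> k = \<beta>' k" "l \<le> start n"
  show ?thesis
  proof (cases "l = start n")
    case False
    then have "start (stage l) < start n"
      using * stage_lower[of l] by linarith
    then have "stage l < n"
      using strict_mono_start by (simp add: strict_mono_less)
    then show ?thesis
      using * by (simp add: base_def Let_def)
  qed (simp add: base_def)
qed

lemma weight_cong:
  "\<lbrakk>\<And>k. k < n \<Longrightarrow> \<beta> k = \<beta>' k; l \<le> start n\<rbrakk> \<Longrightarrow> weight \<beta> N l = weight \<beta>' N l"
  using base_cong[of n \<beta> \<beta>' l] by (simp add: weight_def)

lemma orbit_weight_cong:
  "\<lbrakk>\<And>k. k < n \<Longrightarrow> \<beta> k = \<beta>' k; k \<le> start n\<rbrakk> \<Longrightarrow> orbit_weight \<beta> N k = orbit_weight \<beta>' N k"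
  unfolding orbit_weight_def
  by (intro sum.cong refl weight_cong[of n]) (auto dest: orbit_support_le)

text \<open>
  Large compared with everything that depends only on the earlier values of \<open>\<beta>\<close>: the vectors \<open>T\<^sup>k e\<^sub>0\<close> with
  \<open>k \<le> start n\<close> have their support in the earlier stages.
\<close>

definition large_at :: "(nat \<Rightarrow> nat) \<Rightarrow> nat \<Rightarrow> nat \<Rightarrow> bool" where
  "large_at \<beta> n b \<longleftrightarrow> start (Suc n) \<le> b \<and> (\<forall>k<n. \<beta> k \<le> b) \<and>
     (\<forall>N\<le>n. \<forall>k\<le>start n. 2 * (orbit_weight \<beta> N k + (n + 2) * 6 ^ n + (2 * n + 3) ^ n) \<le> b)"

lemma weight_mono: "M \<le> N \<Longrightarrow> weight \<beta> M l \<le> weight \<beta> N l"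
  using base_pos[of \<beta> l] by (auto simp: weight_def intro: power_increasing)

lemma weight_ge_1: "row l \<le> N \<Longrightarrow> 1 \<le> weight \<beta> N l"
  using base_pos[of \<beta> l] by (simp add: weight_def)

lemma weight_start: "weight \<beta> N (start n) \<le> (2 * n + 1) ^ N"
  using snd_prod_decode_le[of n] by (simp add: weight_def base_def power_mono)

lemma orbit_weight_linked:
  assumes "period n \<le> k" "k < start (Suc n)"
  shows "orbit_weight \<beta> N k = weight \<beta> N k + orbit_weight \<beta> N (k - period n)"
proof -
  have "k \<notin> orbit_support (k - period n)"
    using period_pos[of n] assms orbit_support_le[of k "k - period n"] by (auto simp del: period_pos)
  then show ?thesis
    by (simp add: orbit_weight_def orbit_support_linked[OF assms])
qed

text \<open>
  After its first index a stage starts in its highest row, and there orbit vectors are basis vectors.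
\<close>

lemma orbit_weight_invisible:
  assumes "N < n" "start n < k" "k < 2 * Suc (start n)"
  shows "orbit_weight \<beta> N k = 0"
  using assms period_ge[of n] by (simp add: orbit_weight_def orbit_support_unlinked[of n] weight_def row_first)

context
  fixes \<beta> :: "nat \<Rightarrow> nat" and n :: nat
  assumes gr: "large_at \<beta> n (\<beta> n)"
begin

lemma beta_ge_start: "start (Suc n) \<le> \<beta> n"
  using gr by (simp add: large_at_def)

lemma beta_pos: "1 \<le> \<beta> n"
  using beta_ge_start start_less_Suc[of n] by linarith

lemma beta_mono: "m \<le> n \<Longrightarrow> \<beta> m \<le> \<beta> n"
  using gr by (cases "m = n") (auto simp: large_at_def)

lemma base_bounds:
  assumes "start n < l" "l < start (Suc n)"
  shows "(\<beta> n)\<^sup>2 \<le> base \<beta> l" "base \<beta> l \<le> 6 * (\<beta> n)\<^sup>2"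
proof -
  have st: "stage l = n"
    using assms by (intro stage_eqI) auto
  then have base: "base \<beta> l = 2 * ((\<beta> n)\<^sup>2 + l) + 2"
    using assms by (simp add: base_def)
  then show "(\<beta> n)\<^sup>2 \<le> base \<beta> l" by simp
  have "l \<le> \<beta> n"
    using assms beta_ge_start by linarith
  moreover have "\<beta> n \<le> (\<beta> n)\<^sup>2" "1 \<le> (\<beta> n)\<^sup>2"
    using beta_pos by (simp_all add: power2_eq_square)
  ultimately show "base \<beta> l \<le> 6 * (\<beta> n)\<^sup>2"
    unfolding base by simp
qed

lemma weight_upper:
  assumes "start n < l" "l < start (Suc n)"
  shows "weight \<beta> N l \<le> (6 * (\<beta> n)\<^sup>2) ^ N"
  using power_mono[OF base_bounds(2)[OF assms], of N] by (simp add: weight_def)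

lemma weight_lower:
  assumes "start n < l" "l < start (Suc n)" "row l \<le> N"
  shows "\<beta> n ^ (2 * N) \<le> weight \<beta> N l"
  using power_mono[OF base_bounds(1)[OF assms(1,2)], of N] assms(3)
  by (simp add: weight_def power_mult)

lemma orbit_weight_crude:
  assumes "i < period n" "r * period n + i < start (Suc n)"
  shows "orbit_weight \<beta> N (r * period n + i) \<le> r * (6 * (\<beta> n)\<^sup>2) ^ N + orbit_weight \<beta> N i"
  using assms(2)
proof (induction r)
  case (Suc r)
  have "start n < Suc r * period n + i"
    using start_less_period[of n] by (simp add: trans_less_add1)
  then have "weight \<beta> N (Suc r * period n + i) \<le> (6 * (\<beta> n)\<^sup>2) ^ N"
    using Suc.prems by (intro weight_upper)
  moreover have "orbit_weight \<beta> N (Suc r * period n + i) = weight \<beta> N (Suc r * period n + i) + orbit_weight \<beta> N (r * period n + i)"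
    using Suc.prems by (subst orbit_weight_linked[of n]) auto
  ultimately show ?case
    using Suc by simp
qed simp

text \<open>
  An orbit vector of stage \<open>n\<close> is an old orbit vector plus at most \<open>n + 2\<close> basis vectors of the same stage,
  whose weights are at most \<open>(6 (\<beta> n)\<^sup>2)\<^sup>N\<close>. The next seminorm has weights of order \<open>(\<beta> n)\<^bsup>2 N + 2\<^esup>\<close> in the
  visible rows of the stage, and the surplus \<open>(\<beta> n)\<^sup>2\<close> absorbs the constants and leaves a factor \<open>\<beta> n\<close>.
  The last index, where the next stage begins, carries a small weight by definition.
\<close>

lemma orbit_weight_bound:
  assumes "N \<le> n" "k \<le> start (Suc n)"
  shows "2 * \<beta> n * orbit_weight \<beta> N k \<le> \<beta> n ^ (2 * N + 2)"
proof -
  define D where "D = Max (orbit_weight \<beta> N ` {..start n})"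
  have D_ge: "orbit_weight \<beta> N i \<le> D" if "i \<le> start n" for i
    unfolding D_def using that by (intro Max_ge) auto
  have "D \<in> orbit_weight \<beta> N ` {..start n}"
    unfolding D_def by (intro Max_in) auto
  then have D_le: "2 * (D + (n + 2) * 6 ^ n + (2 * n + 3) ^ n) \<le> \<beta> n"
    using gr assms(1) by (auto simp: large_at_def)
  let ?P = "(6 * (\<beta> n)\<^sup>2) ^ N"
  have small: "orbit_weight \<beta> N i \<le> D + ?P" if "i < period n" for i
  proof (cases "i \<le> start n")
    case False
    then have "orbit_weight \<beta> N i = weight \<beta> N i"
      using that by (simp add: orbit_weight_def orbit_support_unlinked[of n])
    also have "\<dots> \<le> ?P"
      using False that period_less_start[of n] by (intro weight_upper) auto
    finally show ?thesis by simp
  qed (use D_ge in \<open>auto intro: trans_le_add1\<close>)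
  have "orbit_weight \<beta> N k \<le> D + (n + 2) * ?P + (2 * n + 3) ^ N"
  proof (cases "k = start (Suc n)")
    case True
    then have "orbit_weight \<beta> N k = weight \<beta> N k"
      by (simp add: orbit_weight_def orbit_support_unlinked[of "Suc n"] start_less_period)
    also have "\<dots> \<le> (2 * n + 3) ^ N"
      using weight_start[of \<beta> N "Suc n"] True by (simp add: eval_nat_numeral)
    finally show ?thesis by simp
  next
    case False
    then have "k < (n + 2) * period n"
      using assms(2) by (simp add: start_Suc)
    then have q: "k div period n \<le> n + 1"
      by (metis Suc_eq_plus1 add_2_eq_Suc' less_Suc_eq_le less_mult_imp_div_less)
    have "orbit_weight \<beta> N k \<le> (k div period n) * ?P + orbit_weight \<beta> N (k mod period n)"
      using orbit_weight_crude[of "k mod period n" "k div period n" N] False assms(2) by simp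
    also have "\<dots> \<le> (n + 1) * ?P + (D + ?P)"
      using q small[of "k mod period n"] by (intro add_mono mult_right_mono) auto
    finally show ?thesis by (simp add: algebra_simps)
  qed
  also have "\<dots> \<le> (D + (n + 2) * 6 ^ n + (2 * n + 3) ^ n) * \<beta> n ^ (2 * N)"
  proof -
    have 1: "1 \<le> \<beta> n ^ (2 * N)"
      using beta_pos by (rule one_le_power)
    have "D \<le> D * \<beta> n ^ (2 * N)"
      using 1 by simp
    moreover have "(n + 2) * ?P \<le> (n + 2) * (6 ^ n * \<beta> n ^ (2 * N))"
      using assms(1) unfolding power_mult_distrib power_mult
      by (intro mult_left_mono mult_right_mono power_increasing) auto
    moreover have "(2 * n + 3) ^ N * 1 \<le> (2 * n + 3) ^ n * \<beta> n ^ (2 * N)"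
      using assms(1) 1 by (intro mult_mono power_increasing) auto
    ultimately show ?thesis
      unfolding distrib_right[of _ _ "\<beta> n ^ (2 * N)"]
      by (intro add_mono) (simp_all only: mult.assoc mult_1_right)
  qed
  finally have "2 * \<beta> n * orbit_weight \<beta> N k
      \<le> 2 * \<beta> n * ((D + (n + 2) * 6 ^ n + (2 * n + 3) ^ n) * \<beta> n ^ (2 * N))"
    by (rule mult_le_mono2)
  also have "\<dots> = \<beta> n * (2 * (D + (n + 2) * 6 ^ n + (2 * n + 3) ^ n)) * \<beta> n ^ (2 * N)"
    by (simp only: ac_simps)
  also have "\<dots> \<le> \<beta> n * \<beta> n * \<beta> n ^ (2 * N)"
    using D_le by (intro mult_mono) auto
  finally show ?thesis
    by (simp add: power_add power2_eq_square algebra_simps)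
qed

end

section \<open>The weighted sequence space\<close>

definition seminorm :: "(nat \<Rightarrow> nat) \<Rightarrow> nat \<Rightarrow> (nat \<Rightarrow> 'a::real_normed_field) \<Rightarrow> real" where
  "seminorm \<beta> N x = (\<Sum>\<^sub>\<infinity>k. norm (x k) * weight \<beta> N k)"

definition koethe :: "(nat \<Rightarrow> nat) \<Rightarrow> (nat \<Rightarrow> 'a::real_normed_field) set" where
  "koethe \<beta> = {x. \<forall>N. (\<lambda>k. norm (x k) * weight \<beta> N k) summable_on UNIV}"

definition unit_vec :: "nat \<Rightarrow> nat \<Rightarrow> 'a::real_normed_field" where
  "unit_vec l k = (if k = l then 1 else 0)"

definition orbit :: "nat \<Rightarrow> nat \<Rightarrow> 'a::real_normed_field" where
  "orbit l k = (if k \<in> orbit_support l then 1 else 0)"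

text \<open>
  The vector \<open>T\<^sup>h e\<^sub>l\<close>, because \<open>e\<^sub>l\<close> is the difference of the orbit vectors with indices \<open>l\<close> and
  \<open>l - period\<close> if \<open>l\<close> is linked, and an orbit vector otherwise.
\<close>

definition iterated_unit :: "nat \<Rightarrow> nat \<Rightarrow> nat \<Rightarrow> 'a::real_normed_field" where
  "iterated_unit h l k = orbit (l + h) k - (if linked l then orbit (l + h - period (stage l)) k else 0)"

lemma koethe_D:
  "x \<in> koethe \<beta> \<Longrightarrow> (\<lambda>k. norm (x k) * weight \<beta> N k) summable_on A"
  unfolding koethe_def using summable_on_subset_banach by blast

lemma seminorm_nonneg: "0 \<le> seminorm \<beta> N x"
  unfolding seminorm_def by (intro infsum_nonneg) auto

lemma koethe_finite_support:
  assumes "finite A" "\<And>k. k \<notin> A \<Longrightarrow> x k = 0"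
  shows "x \<in> koethe \<beta>" "seminorm \<beta> N x = (\<Sum>k\<in>A. norm (x k) * weight \<beta> N k)"
proof -
  have "((\<lambda>k. norm (x k) * weight \<beta> N k) has_sum (\<Sum>k\<in>A. norm (x k) * weight \<beta> N k)) A" for N
    using assms(1) by (rule has_sum_finite)
  then have *: "((\<lambda>k. norm (x k) * weight \<beta> N k) has_sum (\<Sum>k\<in>A. norm (x k) * weight \<beta> N k)) UNIV" for N
    by (rule has_sum_cong_neutral[THEN iffD1, rotated -1]) (use assms(2) in auto)
  show "x \<in> koethe \<beta>"
    using * unfolding koethe_def summable_on_def by blast
  show "seminorm \<beta> N x = (\<Sum>k\<in>A. norm (x k) * weight \<beta> N k)"
    using * unfolding seminorm_def by (rule infsumI)
qed

lemma unit_vec_in_koethe: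
  "(unit_vec l :: nat \<Rightarrow> 'a::real_normed_field) \<in> koethe \<beta>"
  and seminorm_unit_vec: "seminorm \<beta> N (unit_vec l :: nat \<Rightarrow> 'a::real_normed_field) = weight \<beta> N l"
  using koethe_finite_support[of "{l}" "unit_vec l :: nat \<Rightarrow> 'a" \<beta>] by (auto simp: unit_vec_def)

lemma orbit_in_koethe:
  "(orbit l :: nat \<Rightarrow> 'a::real_normed_field) \<in> koethe \<beta>"
  and seminorm_orbit: "seminorm \<beta> N (orbit l :: nat \<Rightarrow> 'a::real_normed_field) = orbit_weight \<beta> N l"
  using koethe_finite_support[of "orbit_support l" "orbit l :: nat \<Rightarrow> 'a" \<beta>] by (auto simp: orbit_def orbit_weight_def)

lemma koethe_add:
  assumes "x \<in> koethe \<beta>" "y \<in> koethe \<beta>"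
  shows "(\<lambda>k. x k + y k) \<in> koethe \<beta>" "seminorm \<beta> N (\<lambda>k. x k + y k) \<le> seminorm \<beta> N x + seminorm \<beta> N y"
proof -
  have le: "norm (x k + y k) * weight \<beta> N k \<le> norm (x k) * weight \<beta> N k + norm (y k) * weight \<beta> N k" for N k
    using mult_right_mono[OF norm_triangle_ineq, of "weight \<beta> N k" "x k" "y k"]
    by (simp add: distrib_right)
  have sm: "(\<lambda>k. norm (x k) * weight \<beta> N k + norm (y k) * weight \<beta> N k) summable_on UNIV" for N
    using assms by (intro summable_on_add koethe_D)
  have 1: "(\<lambda>k. norm (x k + y k) * weight \<beta> N k) summable_on UNIV" for N
    by (rule summable_on_comparison_test[OF sm[of N]]) (use le in auto)
  then show "(\<lambda>k. x k + y k) \<in> koethe \<beta>"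
    by (simp add: koethe_def)
  have "seminorm \<beta> N (\<lambda>k. x k + y k) \<le> (\<Sum>\<^sub>\<infinity>k. norm (x k) * weight \<beta> N k + norm (y k) * weight \<beta> N k)"
    unfolding seminorm_def by (intro infsum_mono 1 sm le)
  also have "\<dots> = seminorm \<beta> N x + seminorm \<beta> N y"
    unfolding seminorm_def using assms by (intro infsum_add koethe_D)
  finally show "seminorm \<beta> N (\<lambda>k. x k + y k) \<le> seminorm \<beta> N x + seminorm \<beta> N y" .
qed

lemma koethe_cmult:
  assumes "x \<in> koethe \<beta>"
  shows "(\<lambda>k. a * x k) \<in> koethe \<beta>" "seminorm \<beta> N (\<lambda>k. a * x k) = norm a * seminorm \<beta> N x"
  using assms summable_on_cmult_right[OF koethe_D[OF assms, of _ UNIV], of "norm a"]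
  by (auto simp: koethe_def seminorm_def norm_mult mult.assoc infsum_cmult_right')

lemma koethe_diff:
  assumes "x \<in> koethe \<beta>" "y \<in> koethe \<beta>"
  shows "(\<lambda>k. x k - y k) \<in> koethe \<beta>" "seminorm \<beta> N (\<lambda>k. x k - y k) \<le> seminorm \<beta> N x + seminorm \<beta> N y"
  using koethe_add(1)[OF assms(1) koethe_cmult(1)[OF assms(2), of "-1"]]
    koethe_add(2)[OF assms(1) koethe_cmult(1)[OF assms(2), of "-1"], of N] koethe_cmult(2)[OF assms(2), of N "-1"]
  by simp_all

lemma koethe_sum:
  fixes x :: "'i \<Rightarrow> nat \<Rightarrow> 'a::real_normed_field"
  assumes "finite A" "\<And>i. i \<in> A \<Longrightarrow> x i \<in> koethe \<beta>"
  shows "(\<lambda>k. \<Sum>i\<in>A. x i k) \<in> koethe \<beta> \<and> seminorm \<beta> N (\<lambda>k. \<Sum>i\<in>A. x i k) \<le> (\<Sum>i\<in>A. seminorm \<beta> N (x i))"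
  using assms
proof (induction A)
  case empty
  then show ?case
    using koethe_finite_support[of "{}" "\<lambda>_. 0 :: 'a" \<beta>] by simp
next
  case (insert j A)
  then show ?case
    using koethe_add(1)[of "x j" \<beta> "\<lambda>k. \<Sum>i\<in>A. x i k"] koethe_add(2)[of "x j" \<beta> "\<lambda>k. \<Sum>i\<in>A. x i k" N]
    by auto
qed

lemma seminorm_mono:
  assumes "x \<in> koethe \<beta>" "M \<le> N"
  shows "seminorm \<beta> M x \<le> seminorm \<beta> N x"
  unfolding seminorm_def
  using weight_mono[OF assms(2)] by (intro infsum_mono koethe_D[OF assms(1)] mult_left_mono) auto

lemma iterated_unit_in_koethe: "iterated_unit h l \<in> koethe \<beta>"
  unfolding iterated_unit_def
  by (intro koethe_diff(1) orbit_in_koethe) (cases "linked l"; simp add: orbit_in_koethe koethe_finite_support(1)[of "{}"])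

lemma orbit_linked:
  assumes "period n \<le> k" "k < start (Suc n)"
  shows "orbit k i = unit_vec k i + orbit (k - period n) i"
proof -
  have "k \<notin> orbit_support (k - period n)"
    using orbit_support_le[of k "k - period n"] period_pos[of n] assms(1) by (auto simp del: period_pos)
  then show ?thesis
    unfolding orbit_def unit_vec_def orbit_support_linked[OF assms] by simp
qed

locale fast_weights =
  fixes \<beta> :: "nat \<Rightarrow> nat"
  assumes gr: "large_at \<beta> n (\<beta> n)"
begin

lemmas beta_pos = beta_pos[OF gr]
lemmas beta_mono = beta_mono[OF gr]
lemmas weight_lower = weight_lower[OF gr]
lemmas orbit_weight_bound = orbit_weight_bound[OF gr]

lemma orbit_weight_bound':
  assumes "N \<le> n" "k < 2 * Suc (start (Suc n))"
  shows "2 * \<beta> n * orbit_weight \<beta> N k \<le> \<beta> n ^ (2 * N + 2)"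
  using assms orbit_weight_bound[of N n k] orbit_weight_invisible[of N "Suc n" k \<beta>] by (cases "k \<le> start (Suc n)") auto

lemma seminorm_iterated_unit_le:
  "seminorm \<beta> N (iterated_unit h l :: nat \<Rightarrow> 'a::real_normed_field) \<le>
     orbit_weight \<beta> N (l + h) + (if linked l then orbit_weight \<beta> N (l + h - period (stage l)) else 0)"
proof (cases "linked l")
  case True
  then show ?thesis
    using koethe_diff(2)[OF orbit_in_koethe orbit_in_koethe, of \<beta> N "l + h" "l + h - period (stage l)", where 'a='a]
    by (simp add: iterated_unit_def[abs_def] seminorm_orbit)
next
  case False
  then have "(iterated_unit h l :: nat \<Rightarrow> 'a) = orbit (l + h)"
    by (simp add: iterated_unit_def fun_eq_iff)
  then show ?thesis
    using False by (simp add: seminorm_orbit)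
qed

text \<open>
  If \<open>e\<^sub>l\<close> is visible for the seminorm \<open>M + 2\<close>, no cancellation is needed: both orbit vectors in
  \<open>T\<^sup>h e\<^sub>l\<close> are small compared with \<open>e\<^sub>l\<close>.
\<close>

lemma iterated_unit_bound_low:
  assumes "start n < l" "l < start (Suc n)" "row l \<le> M + 2" "M + 2 \<le> n" "h < 2 * period n"
  shows "\<beta> n * seminorm \<beta> M (iterated_unit h l :: nat \<Rightarrow> 'a::real_normed_field) \<le> weight \<beta> (M + 2) l"
proof -
  have lh: "l + h < 2 * Suc (start (Suc n))"
    using assms start_Suc_ge[of n] by simp
  define a where "a = orbit_weight \<beta> M (l + h)"
  define b where "b = (if linked l then orbit_weight \<beta> M (l + h - period (stage l)) else 0)"
  have "2 * \<beta> n * a \<le> \<beta> n ^ (2 * M + 2)"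
    unfolding a_def using lh assms by (intro orbit_weight_bound') auto
  moreover have "2 * \<beta> n * b \<le> \<beta> n ^ (2 * M + 2)"
    unfolding b_def using lh assms orbit_weight_bound'[of M n "l + h - period (stage l)"] by simp
  ultimately have "2 * (\<beta> n * (a + b)) \<le> 2 * (\<beta> n ^ (2 * M + 2))"
    unfolding distrib_left mult.assoc by linarith
  then have "\<beta> n * (a + b) \<le> \<beta> n ^ (2 * M + 2)"
    by simp
  also have "\<dots> \<le> \<beta> n ^ (2 * (M + 2))"
    using beta_pos[of n] by (intro power_increasing) auto
  also have "\<dots> \<le> weight \<beta> (M + 2) l"
    using assms by (intro weight_lower) auto
  finally have "\<beta> n * (a + b) \<le> weight \<beta> (M + 2) l" .
  then have "real (\<beta> n) * real (a + b) \<le> weight \<beta> (M + 2) l"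
    by (metis of_nat_le_iff of_nat_mult)
  moreover have "\<beta> n * seminorm \<beta> M (iterated_unit h l :: nat \<Rightarrow> 'a) \<le> \<beta> n * real (a + b)"
    using seminorm_iterated_unit_le[of M h l, where 'a='a] by (intro mult_left_mono) (auto simp: a_def b_def)
  ultimately show ?thesis by linarith
qed

text \<open>
  If \<open>e\<^sub>l\<close> is invisible for the seminorm \<open>M + 2\<close>, so is \<open>T\<^sup>h e\<^sub>l\<close> for the seminorm \<open>M\<close>: the orbit vectors
  cancel except for basis vectors whose rows are at most two below the row of \<open>l\<close>, or equal to \<open>n\<close>. The shift
  by exactly one period is excluded, since it would reproduce the exceptional vector with index \<open>start n\<close>.
\<close>

lemma iterated_unit_bound_high:
  assumes "start n \<le> l" "l < start (Suc n)" "l = start n \<or> M + 2 < row l" "M + 2 \<le> n"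
    and "h \<in> {1..start n} \<union> {period n + 1..period n + start n}"
  shows "seminorm \<beta> M (iterated_unit h l :: nat \<Rightarrow> 'a::real_normed_field) = 0"
proof -
  let ?B = "Suc (start n)"
  have h_less: "h < 2 * period n"
    using assms(5) start_less_period[of n] by auto
  have block1: "orbit_weight \<beta> M (period n + i) = orbit_weight \<beta> M i" if "i < period n" for i
  proof -
    have "row (period n + i) = n"
      using row_block[of 1 n i] that by simp
    then show ?thesis
      using orbit_weight_linked[of n "period n + i" \<beta> M] start_Suc_ge[of n] that assms(4) by (simp add: weight_def)
  qed
  have unlinked: "seminorm \<beta> M (iterated_unit h l :: nat \<Rightarrow> 'a) = 0"
    if "\<not> linked l" and *: "\<And>i. i \<in> {1..start n} \<Longrightarrow> orbit_weight \<beta> M (l + i) = 0 \<and> l + i < period n"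
  proof -
    have "orbit_weight \<beta> M (l + h) = 0"
    proof (cases "h \<le> start n")
      case False
      then have "h - period n \<in> {1..start n}" "h = period n + (h - period n)"
        using assms(5) by auto
      then obtain i where "i \<in> {1..start n}" "h = period n + i"
        by blast
      then show ?thesis
        using *[of i] block1[of "l + i"] by (simp add: algebra_simps)
    qed (use * assms(5) in auto)
    then show ?thesis
      using seminorm_iterated_unit_le[of M h l, where 'a='a] that(1) seminorm_nonneg[of \<beta> M "iterated_unit h l :: nat \<Rightarrow> 'a"] by simp
  qed
  consider "l = start n" | "start n < l" "l < period n" | "period n \<le> l"
    using assms by linarith
  then show ?thesis
  proof cases
    case 1
    show ?thesis
    proof (rule unlinked)
      show "\<not> linked l"
        using 1 not_linkedI[of n l] start_less_period[of n] by simp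
      fix i assume "i \<in> {1..start n}"
      then show "orbit_weight \<beta> M (l + i) = 0 \<and> l + i < period n"
        using 1 orbit_weight_invisible[of M n "l + i" \<beta>] assms(4) period_ge[of n] by auto
    qed
  next
    case 2
    show ?thesis
    proof (rule unlinked)
      show "\<not> linked l"
        using 2 not_linkedI[of n l] by simp
      fix i assume i: "i \<in> {1..start n}"
      have q: "l div ?B + M + 2 \<le> n"
        using assms(3) 2 row_unlinked[of n l] by auto
      have "(l + i) div ?B \<le> (l + ?B) div ?B"
        using i by (intro div_le_mono) auto
      also have "\<dots> = l div ?B + 1"
        by (subst div_add_self2) auto
      finally have d: "(l + i) div ?B \<le> l div ?B + 1" .
      then have "(l + i) div ?B < n + 2"
        using q by linarith
      then have less: "l + i < period n"
        unfolding period_def by (simp add: div_less_iff_less_mult del: mult_Suc mult_Suc_right)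
      then have "row (l + i) = Suc n - (l + i) div ?B"
        using 2 by (intro row_unlinked) auto
      then have "M < row (l + i)"
        using d q by linarith
      then show "orbit_weight \<beta> M (l + i) = 0 \<and> l + i < period n"
        using less 2 by (simp add: orbit_weight_def orbit_support_unlinked[of n] weight_def)
    qed
  next
    case 3
    have q: "l div period n + M + 2 \<le> n"
      using assms(2,3) 3 row_linked[of n l] start_less_period[of n] by auto
    have "(l + h) div period n \<le> (l + 2 * period n) div period n"
      using h_less by (intro div_le_mono) auto
    also have "\<dots> = l div period n + 2"
      by simp
    finally have d: "(l + h) div period n \<le> l div period n + 2" .
    then have "(l + h) div period n < n + 2"
      using q by linarith
    then have less: "l + h < start (Suc n)"
      unfolding start_Suc by (simp add: div_less_iff_less_mult)
    then have "row (l + h) = Suc n - (l + h) div period n"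
      using 3 by (intro row_linked) auto
    then have r: "M < row (l + h)"
      using d q by linarith
    have "(iterated_unit h l :: nat \<Rightarrow> 'a) = unit_vec (l + h)"
      using 3 assms(2) linkedI[of n l] orbit_linked[of n "l + h", where 'a='a] less
      by (simp add: iterated_unit_def fun_eq_iff)
    then show ?thesis
      using r by (simp add: seminorm_unit_vec weight_def)
  qed
qed

text \<open>
  Shifts that are admissible for stage \<open>n\<close> are short, hence admissible, for every later stage.
\<close>

lemma iterated_unit_bound:
  assumes "start n \<le> l" "M + 2 \<le> n" "h \<in> {1..start n} \<union> {period n + 1..period n + start n}"
  shows "\<beta> n * seminorm \<beta> M (iterated_unit h l :: nat \<Rightarrow> 'a::real_normed_field) \<le> weight \<beta> (M + 2) l"
proof -
  define k where "k = stage l"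
  have k: "start k \<le> l" "l < start (Suc k)"
    using stage_lower stage_upper by (auto simp: k_def)
  then have "start n < start (Suc k)"
    using assms(1) by linarith
  then have nk: "n \<le> k"
    using strict_mono_start by (simp add: strict_mono_less)
  have h: "h \<in> {1..start k} \<union> {period k + 1..period k + start k}"
  proof (cases "n = k")
    case False
    then have "start (Suc n) \<le> start k"
      using nk by (intro start_mono) auto
    then show ?thesis
      using assms(3) start_Suc_ge[of n] start_less_period[of n] by auto
  qed (use assms in auto)
  have "\<beta> k * seminorm \<beta> M (iterated_unit h l :: nat \<Rightarrow> 'a) \<le> weight \<beta> (M + 2) l"
  proof (cases "l = start k \<or> M + 2 < row l")
    case True
    then show ?thesis
      using k iterated_unit_bound_high[of k l M h, where 'a='a] h nk assms(2) by auto
  next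
    case False
    then show ?thesis
      using k h nk assms(2) start_less_period[of k] by (intro iterated_unit_bound_low) auto
  qed
  moreover have "\<beta> n * seminorm \<beta> M (iterated_unit h l :: nat \<Rightarrow> 'a) \<le> \<beta> k * seminorm \<beta> M (iterated_unit h l :: nat \<Rightarrow> 'a)"
    using beta_mono[OF nk] by (intro mult_right_mono seminorm_nonneg) auto
  ultimately show ?thesis by linarith
qed

end

section \<open>The operator and its iterates\<close>

definition shift_op :: "(nat \<Rightarrow> 'a::real_normed_field) \<Rightarrow> nat \<Rightarrow> 'a" where
  "shift_op x k = (\<Sum>\<^sub>\<infinity>l. x l * iterated_unit 1 l k)"

definition head :: "nat \<Rightarrow> (nat \<Rightarrow> 'a::zero) \<Rightarrow> nat \<Rightarrow> 'a" where
  "head m x k = (if k < m then x k else 0)"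

definition tail :: "nat \<Rightarrow> (nat \<Rightarrow> 'a::zero) \<Rightarrow> nat \<Rightarrow> 'a" where
  "tail m x k = (if k < m then 0 else x k)"

text \<open>
  A matrix whose columns are bounded by the weights of another seminorm defines an operator, by absolute
  convergence of the double series.
\<close>

lemma matrix_operator:
  fixes \<tau> :: "nat \<Rightarrow> nat \<Rightarrow> 'a::{real_normed_field, banach}"
    and c :: real
  assumes \<tau>: "\<And>l. \<tau> l \<in> koethe \<beta>" and bound: "\<And>l. seminorm \<beta> N (\<tau> l) \<le> c * weight \<beta> N' l"
    and x: "x \<in> koethe \<beta>"
  shows "row k \<le> N \<Longrightarrow> (\<lambda>l. x l * \<tau> l k) summable_on UNIV"
    and "(\<lambda>k. norm (\<Sum>\<^sub>\<infinity>l. x l * \<tau> l k) * weight \<beta> N k) summable_on UNIV"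
    and "seminorm \<beta> N (\<lambda>k. \<Sum>\<^sub>\<infinity>l. x l * \<tau> l k) \<le> c * seminorm \<beta> N' x"
proof -
  define g where "g = (\<lambda>(l, k). norm (x l) * (norm (\<tau> l k) * weight \<beta> N k))"
  have g_nonneg: "0 \<le> g p" for p
    by (auto simp: g_def split: prod.splits)
  have inner: "(\<lambda>k. g (l, k)) summable_on UNIV" for l
    unfolding g_def using koethe_D[OF \<tau>] by (simp add: summable_on_cmult_right)
  have inner_sum: "(\<Sum>\<^sub>\<infinity>k. g (l, k)) = norm (x l) * seminorm \<beta> N (\<tau> l)" for l
    unfolding g_def seminorm_def by (simp add: infsum_cmult_right')
  have nonneg: "0 \<le> norm (x l) * seminorm \<beta> N (\<tau> l)" for l
    by (intro mult_nonneg_nonneg norm_ge_zero seminorm_nonneg)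
  have le: "norm (x l) * seminorm \<beta> N (\<tau> l) \<le> c * (norm (x l) * weight \<beta> N' l)" for l
    using mult_left_mono[OF bound[of l], of "norm (x l)"] by (simp add: mult.left_commute)
  have csum: "(\<lambda>l. c * (norm (x l) * weight \<beta> N' l)) summable_on UNIV"
    by (intro summable_on_cmult_right koethe_D x)
  have outer: "(\<lambda>l. norm (x l) * seminorm \<beta> N (\<tau> l)) summable_on UNIV"
    by (rule summable_on_comparison_test[OF csum]) (use le nonneg in auto)
  have g: "(\<lambda>p. norm (g p)) summable_on UNIV \<times> UNIV"
    using g_nonneg inner outer unfolding Infinite_Sum.abs_summable_on_Sigma_iff by (simp add: inner_sum seminorm_nonneg)
  then have g': "(\<lambda>(l, k). g (l, k)) summable_on UNIV \<times> UNIV"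
    by (simp add: g_nonneg)
  have "(\<lambda>p. norm ((\<lambda>(k, l). g (l, k)) p)) summable_on UNIV \<times> UNIV"
    using g summable_on_reindex_bij_betw[of prod.swap "UNIV \<times> UNIV" "UNIV \<times> UNIV" "\<lambda>p. norm (g p)"]
      bij_betwI[of prod.swap "UNIV \<times> UNIV" "UNIV \<times> UNIV" prod.swap]
    by (simp add: prod.swap_def case_prod_beta)
  then have "(\<forall>k. (\<lambda>l. g (l, k)) summable_on UNIV) \<and> (\<lambda>k. \<Sum>\<^sub>\<infinity>l. g (l, k)) summable_on UNIV"
    unfolding Infinite_Sum.abs_summable_on_Sigma_iff by (auto simp: g_nonneg infsum_nonneg)
  then have col: "(\<lambda>l. g (l, k)) summable_on UNIV"
    and sums: "(\<lambda>k. \<Sum>\<^sub>\<infinity>l. g (l, k)) summable_on UNIV" for k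
    by auto
  have abs: "(\<lambda>l. norm (x l * \<tau> l k)) summable_on UNIV" if "row k \<le> N" for k
  proof (rule Infinite_Sum.abs_summable_on_comparison_test)
    show "(\<lambda>l. norm (g (l, k))) summable_on UNIV"
      using col by (simp add: g_nonneg)
    fix l
    have "norm (x l * \<tau> l k) * 1 \<le> norm (x l * \<tau> l k) * weight \<beta> N k"
      using weight_ge_1[OF that, of \<beta>] by (intro mult_left_mono) auto
    then show "norm (x l * \<tau> l k) \<le> norm (g (l, k))"
      by (simp add: g_def norm_mult mult.assoc)
  qed
  then show "row k \<le> N \<Longrightarrow> (\<lambda>l. x l * \<tau> l k) summable_on UNIV"
    by (rule abs_summable_summable)
  have le2: "norm (\<Sum>\<^sub>\<infinity>l. x l * \<tau> l k) * weight \<beta> N k \<le> (\<Sum>\<^sub>\<infinity>l. g (l, k))" for k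
  proof (cases "row k \<le> N")
    case True
    have "norm (\<Sum>\<^sub>\<infinity>l. x l * \<tau> l k) * weight \<beta> N k \<le> (\<Sum>\<^sub>\<infinity>l. norm (x l * \<tau> l k)) * weight \<beta> N k"
      using norm_infsum_bound[OF abs[OF True]] by (intro mult_right_mono) auto
    also have "\<dots> = (\<Sum>\<^sub>\<infinity>l. weight \<beta> N k * norm (x l * \<tau> l k))"
      by (simp add: infsum_cmult_right' mult.commute)
    finally show ?thesis
      by (simp add: g_def norm_mult mult_ac)
  qed (auto simp: weight_def intro!: infsum_nonneg g_nonneg)
  show 2: "(\<lambda>k. norm (\<Sum>\<^sub>\<infinity>l. x l * \<tau> l k) * weight \<beta> N k) summable_on UNIV"
    by (rule summable_on_comparison_test[OF sums]) (use le2 in auto)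
  have "seminorm \<beta> N (\<lambda>k. \<Sum>\<^sub>\<infinity>l. x l * \<tau> l k) \<le> (\<Sum>\<^sub>\<infinity>k. \<Sum>\<^sub>\<infinity>l. g (l, k))"
    unfolding seminorm_def by (intro infsum_mono 2 sums le2)
  also have "\<dots> = (\<Sum>\<^sub>\<infinity>l. \<Sum>\<^sub>\<infinity>k. g (l, k))"
    using infsum_swap_banach[of "\<lambda>l k. g (l, k)", OF g'] by simp
  also have "\<dots> = (\<Sum>\<^sub>\<infinity>l. norm (x l) * seminorm \<beta> N (\<tau> l))"
    by (simp add: inner_sum)
  also have "\<dots> \<le> (\<Sum>\<^sub>\<infinity>l. c * (norm (x l) * weight \<beta> N' l))"
    by (intro infsum_mono outer csum le)
  also have "\<dots> = c * seminorm \<beta> N' x"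
    by (simp add: infsum_cmult_right' seminorm_def)
  finally show "seminorm \<beta> N (\<lambda>k. \<Sum>\<^sub>\<infinity>l. x l * \<tau> l k) \<le> c * seminorm \<beta> N' x" .
qed

lemma head_in_koethe:
  "head m x \<in> koethe \<beta>"
  and seminorm_head: "seminorm \<beta> N (head m x) = (\<Sum>k<m. norm (x k) * weight \<beta> N k)"
  using koethe_finite_support[of "{..<m}" "head m x" \<beta>] by (auto simp: head_def)

lemma tail_eq: "tail m x = (\<lambda>k. x k - head m x k :: 'a::ab_group_add)"
  by (rule ext) (simp add: tail_def head_def)

lemma tail_in_koethe: "x \<in> koethe \<beta> \<Longrightarrow> tail m x \<in> koethe \<beta>"
  unfolding tail_eq by (intro koethe_diff head_in_koethe)

lemma seminorm_head_tail:
  assumes "x \<in> koethe \<beta>"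
  shows "seminorm \<beta> N x = seminorm \<beta> N (head m x) + seminorm \<beta> N (tail m x)"
proof -
  have "norm (x k) * weight \<beta> N k = norm (head m x k) * weight \<beta> N k + norm (tail m x k) * weight \<beta> N k" for k
    by (simp add: head_def tail_def)
  then show ?thesis
    unfolding seminorm_def using infsum_add[OF koethe_D[OF head_in_koethe] koethe_D[OF tail_in_koethe[OF assms]]] by simp
qed

lemma seminorm_head_tendsto:
  assumes "x \<in> koethe \<beta>"
  shows "(\<lambda>m. seminorm \<beta> N (head m x)) \<longlonglongrightarrow> seminorm \<beta> N x"
proof -
  have "((\<lambda>k. norm (x k) * weight \<beta> N k) has_sum seminorm \<beta> N x) UNIV"
    unfolding seminorm_def using koethe_D[OF assms] by (rule has_sum_infsum)
  then show ?thesis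
    unfolding seminorm_head using has_sum_imp_sums sums_def by blast
qed

lemma seminorm_tail_tendsto:
  assumes "x \<in> koethe \<beta>"
  shows "(\<lambda>m. seminorm \<beta> N (tail m x)) \<longlonglongrightarrow> 0"
proof -
  have "(\<lambda>m. seminorm \<beta> N x - seminorm \<beta> N (head m x)) \<longlonglongrightarrow> seminorm \<beta> N x - seminorm \<beta> N x"
    by (intro tendsto_intros seminorm_head_tendsto assms)
  moreover have "seminorm \<beta> N (tail m x) = seminorm \<beta> N x - seminorm \<beta> N (head m x)" for m
    using seminorm_head_tail[OF assms, of N m] by simp
  ultimately show ?thesis by simp
qed

context fast_weights
begin

text \<open>
  From stage \<open>N + 2\<close> on the constant is \<open>1\<close>. The finitely many earlier vectors lie in rows up to \<open>N + 1\<close>,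
  so their weights in seminorm \<open>N + 2\<close> do not vanish.
\<close>

lemma iterated_unit_1_bound:
  obtains c :: real where "0 \<le> c" "\<And>l. seminorm \<beta> N (iterated_unit 1 l :: nat \<Rightarrow> 'a::real_normed_field) \<le> c * weight \<beta> (N + 2) l"
proof
  let ?p = "\<lambda>l. seminorm \<beta> N (iterated_unit 1 l :: nat \<Rightarrow> 'a)"
  let ?c = "1 + (\<Sum>l<start (N + 2). ?p l)"
  have c: "1 \<le> ?c"
    by (auto intro!: sum_nonneg seminorm_nonneg)
  then show "0 \<le> ?c" by linarith
  fix l
  show "?p l \<le> ?c * weight \<beta> (N + 2) l"
  proof (cases "l < start (N + 2)")
    case True
    then have "start (stage l) < start (N + 2)"
      using stage_lower[of l] by linarith
    then have "row l \<le> N + 2"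
      using row_le_stage[of l] strict_mono_less[OF strict_mono_start] by simp
    then have "1 \<le> weight \<beta> (N + 2) l"
      by (rule weight_ge_1)
    moreover have "?p l \<le> ?c"
      using member_le_sum[of l "{..<start (N + 2)}" ?p] True seminorm_nonneg by fastforce
    ultimately show ?thesis
      using mult_mono[of "?p l" ?c 1 "weight \<beta> (N + 2) l"] c by simp
  next
    case False
    have "1 \<le> start (N + 2)"
      using start_ge[of "N + 2"] by linarith
    then have "\<beta> (N + 2) * ?p l \<le> weight \<beta> (N + 2) l"
      using iterated_unit_bound[of "N + 2" l N 1, where 'a='a] False by auto
    moreover have "1 * ?p l \<le> \<beta> (N + 2) * ?p l"
      using beta_pos[of "N + 2"] by (intro mult_right_mono seminorm_nonneg) auto
    moreover have "1 * real (weight \<beta> (N + 2) l) \<le> ?c * weight \<beta> (N + 2) l"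
      using c by (intro mult_right_mono) auto
    ultimately show ?thesis by linarith
  qed
qed

lemma shift_op_bound:
  obtains c :: real where "0 \<le> c"
    "\<And>x :: nat \<Rightarrow> 'a::{real_normed_field, banach}. x \<in> koethe \<beta> \<Longrightarrow> seminorm \<beta> N (shift_op x) \<le> c * seminorm \<beta> (N + 2) x"
proof -
  obtain c :: real where c: "0 \<le> c"
    "\<And>l. seminorm \<beta> N (iterated_unit 1 l :: nat \<Rightarrow> 'a) \<le> c * weight \<beta> (N + 2) l"
    using iterated_unit_1_bound[where 'a='a] by metis
  have "seminorm \<beta> N (shift_op x) \<le> c * seminorm \<beta> (N + 2) x" if "x \<in> koethe \<beta>" for x :: "nat \<Rightarrow> 'a"
    using matrix_operator(3)[OF iterated_unit_in_koethe c(2) that] unfolding shift_op_def[abs_def] .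
  with c(1) show thesis by (rule that)
qed

lemma shift_op_in_koethe:
  fixes x :: "nat \<Rightarrow> 'a::{real_normed_field, banach}"
  assumes "x \<in> koethe \<beta>"
  shows "shift_op x \<in> koethe \<beta>"
  unfolding koethe_def
proof safe
  fix N
  obtain c :: real where c: "0 \<le> c" "\<And>l. seminorm \<beta> N (iterated_unit 1 l :: nat \<Rightarrow> 'a) \<le> c * weight \<beta> (N + 2) l"
    using iterated_unit_1_bound[where 'a='a] by blast
  show "(\<lambda>k. norm (shift_op x k) * weight \<beta> N k) summable_on UNIV"
    unfolding shift_op_def[abs_def] by (rule matrix_operator(2)[OF iterated_unit_in_koethe c(2) assms])
qed

lemma shift_op_summable:
  fixes x :: "nat \<Rightarrow> 'a::{real_normed_field, banach}"
  assumes "x \<in> koethe \<beta>"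
  shows "(\<lambda>l. x l * iterated_unit 1 l k) summable_on UNIV"
proof -
  obtain c :: real where c: "0 \<le> c" "\<And>l. seminorm \<beta> (row k) (iterated_unit 1 l :: nat \<Rightarrow> 'a) \<le> c * weight \<beta> (row k + 2) l"
    using iterated_unit_1_bound[where 'a='a] by blast
  show ?thesis
    by (rule matrix_operator(1)[OF iterated_unit_in_koethe c(2) assms order_refl])
qed

lemma shift_op_add:
  fixes x y :: "nat \<Rightarrow> 'a::{real_normed_field, banach}"
  assumes "x \<in> koethe \<beta>" "y \<in> koethe \<beta>"
  shows "shift_op (\<lambda>k. x k + y k) = (\<lambda>k. shift_op x k + shift_op y k)"
  unfolding shift_op_def[abs_def] distrib_right using assms by (intro ext infsum_add shift_op_summable)

lemma shift_op_cmult: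
  fixes x :: "nat \<Rightarrow> 'a::{real_normed_field, banach}"
  shows "shift_op (\<lambda>k. a * x k) = (\<lambda>k. a * shift_op x k)"
  by (simp add: shift_op_def[abs_def] mult.assoc infsum_cmult_right')

lemma iterate_in_koethe:
  fixes x :: "nat \<Rightarrow> 'a::{real_normed_field, banach}"
  shows "x \<in> koethe \<beta> \<Longrightarrow> (shift_op ^^ h) x \<in> koethe \<beta>"
  by (induction h) (auto intro: shift_op_in_koethe)

lemma iterate_add:
  fixes x y :: "nat \<Rightarrow> 'a::{real_normed_field, banach}"
  assumes "x \<in> koethe \<beta>" "y \<in> koethe \<beta>"
  shows "(shift_op ^^ h) (\<lambda>k. x k + y k) = (\<lambda>k. (shift_op ^^ h) x k + (shift_op ^^ h) y k)"
  using assms by (induction h) (auto simp: shift_op_add iterate_in_koethe)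

lemma iterate_cmult:
  fixes x :: "nat \<Rightarrow> 'a::{real_normed_field, banach}"
  shows "(shift_op ^^ h) (\<lambda>k. a * x k) = (\<lambda>k. a * (shift_op ^^ h) x k)"
  by (induction h) (auto simp: shift_op_cmult)

lemma iterate_sum:
  fixes x :: "'i \<Rightarrow> nat \<Rightarrow> 'a::{real_normed_field, banach}"
  assumes "finite A" "\<And>i. i \<in> A \<Longrightarrow> x i \<in> koethe \<beta>"
  shows "(shift_op ^^ h) (\<lambda>k. \<Sum>i\<in>A. a i * x i k) = (\<lambda>k. \<Sum>i\<in>A. a i * (shift_op ^^ h) (x i) k)"
  using assms
proof (induction A)
  case empty
  show ?case
    using iterate_cmult[of h 0 "\<lambda>_. 0 :: 'a"] by simp
next
  case (insert j A)
  then have "(\<lambda>k. \<Sum>i\<in>A. a i * x i k) \<in> koethe \<beta>" "(\<lambda>k. a j * x j k) \<in> koethe \<beta>"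
    using koethe_sum[of A "\<lambda>i k. a i * x i k" \<beta>] by (auto intro: koethe_cmult)
  then show ?case
    using insert by (simp add: iterate_add iterate_cmult)
qed

lemma iterate_bound:
  obtains c :: real and M where "0 \<le> c"
    "\<And>x :: nat \<Rightarrow> 'a::{real_normed_field, banach}. x \<in> koethe \<beta> \<Longrightarrow> seminorm \<beta> N ((shift_op ^^ h) x) \<le> c * seminorm \<beta> M x"
proof -
  have "\<exists>(c::real) M. 0 \<le> c \<and> (\<forall>x :: nat \<Rightarrow> 'a. x \<in> koethe \<beta> \<longrightarrow> seminorm \<beta> N ((shift_op ^^ h) x) \<le> c * seminorm \<beta> M x)"
  proof (induction h)
    case 0
    show ?case by (intro exI[of _ 1] exI[of _ N]) auto
  next
    case (Suc h)
    then obtain c :: real and M where c: "0 \<le> c"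
      "\<And>x :: nat \<Rightarrow> 'a. x \<in> koethe \<beta> \<Longrightarrow> seminorm \<beta> N ((shift_op ^^ h) x) \<le> c * seminorm \<beta> M x"
      by blast
    obtain d :: real where d: "0 \<le> d" "\<And>x :: nat \<Rightarrow> 'a. x \<in> koethe \<beta> \<Longrightarrow> seminorm \<beta> M (shift_op x) \<le> d * seminorm \<beta> (M + 2) x"
      using shift_op_bound[where 'a='a] by metis
    have "seminorm \<beta> N ((shift_op ^^ Suc h) x) \<le> (c * d) * seminorm \<beta> (M + 2) x" if x: "x \<in> koethe \<beta>" for x :: "nat \<Rightarrow> 'a"
    proof -
      have "seminorm \<beta> N ((shift_op ^^ Suc h) x) \<le> c * seminorm \<beta> M (shift_op x)"
        unfolding funpow_Suc_right o_def using c(2)[OF shift_op_in_koethe[OF x]] .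
      also have "\<dots> \<le> c * (d * seminorm \<beta> (M + 2) x)"
        using c(1) d(2)[OF x] by (rule mult_left_mono[rotated])
      finally show ?thesis by (simp add: mult.assoc)
    qed
    then show ?case
      using c(1) d(1) by (intro exI[of _ "c * d"] exI[of _ "M + 2"]) auto
  qed
  then show thesis using that by blast
qed

lemma shift_op_unit_vec:
  "shift_op (unit_vec l :: nat \<Rightarrow> 'a::{real_normed_field, banach}) = iterated_unit 1 l"
proof
  fix k
  have "shift_op (unit_vec l :: nat \<Rightarrow> 'a) k = (\<Sum>\<^sub>\<infinity>j\<in>{l}. unit_vec l j * iterated_unit 1 j k)"
    unfolding shift_op_def by (intro infsum_cong_neutral) (auto simp: unit_vec_def)
  then show "shift_op (unit_vec l :: nat \<Rightarrow> 'a) k = iterated_unit 1 l k"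
    by (simp add: unit_vec_def)
qed

lemma orbit_unit_vec:
  "orbit l k = unit_vec l k + (if linked l then orbit (l - period (stage l)) k else 0)"
proof (cases "linked l")
  case True
  then show ?thesis
    using orbit_linked[of "stage l" l k] stage_upper[of l] by (simp add: linked_def)
next
  case False
  then show ?thesis
    by (simp add: orbit_def unit_vec_def orbit_support.simps[of l])
qed

lemma shift_op_orbit:
  "shift_op (orbit l :: nat \<Rightarrow> 'a::{real_normed_field, banach}) = orbit (Suc l)"
proof (induction l rule: less_induct)
  case (less l)
  show ?case
  proof (cases "linked l")
    case True
    define j where "j = l - period (stage l)"
    have j: "j < l" "Suc l - period (stage l) = Suc j"
      using True period_pos[of "stage l"] by (auto simp: j_def linked_def simp del: period_pos)
    have "(orbit l :: nat \<Rightarrow> 'a) = (\<lambda>k. unit_vec l k + orbit j k)"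
      using True orbit_unit_vec[of l, where 'a='a] by (simp add: j_def fun_eq_iff)
    then have "shift_op (orbit l :: nat \<Rightarrow> 'a) = shift_op (\<lambda>k. unit_vec l k + orbit j k)"
      by simp
    also have "\<dots> = (\<lambda>k. iterated_unit 1 l k + orbit (Suc j) k)"
      using less j by (simp add: shift_op_add unit_vec_in_koethe orbit_in_koethe shift_op_unit_vec)
    also have "\<dots> = orbit (Suc l)"
      using True j by (simp add: iterated_unit_def fun_eq_iff)
    finally show ?thesis .
  next
    case False
    then have "(orbit l :: nat \<Rightarrow> 'a) = unit_vec l"
      using orbit_unit_vec[of l, where 'a='a] by (simp add: fun_eq_iff)
    then show ?thesis
      using False by (simp add: shift_op_unit_vec iterated_unit_def fun_eq_iff)
  qed
qed

lemma iterate_orbit: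
  "(shift_op ^^ h) (orbit l :: nat \<Rightarrow> 'a::{real_normed_field, banach}) = orbit (l + h)"
  by (induction h) (auto simp: shift_op_orbit)

lemma iterate_unit_vec:
  "(shift_op ^^ h) (unit_vec l :: nat \<Rightarrow> 'a::{real_normed_field, banach}) = iterated_unit h l"
proof (cases "linked l")
  case True
  define j where "j = l - period (stage l)"
  have "unit_vec l = (\<lambda>k. orbit l k + (-1) * orbit j k :: 'a)"
    using True orbit_unit_vec[of l, where 'a='a] by (simp add: j_def fun_eq_iff)
  then have "(shift_op ^^ h) (unit_vec l) = (shift_op ^^ h) (\<lambda>k. orbit l k + (-1) * orbit j k :: 'a)"
    by simp
  also have "\<dots> = (\<lambda>k. orbit (l + h) k + (-1) * orbit (j + h) k :: 'a)"
    by (simp only: iterate_add iterate_cmult iterate_orbit orbit_in_koethe koethe_cmult)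
  also have "\<dots> = iterated_unit h l"
    using True by (simp add: iterated_unit_def fun_eq_iff j_def linked_def)
  finally show ?thesis .
next
  case False
  then have "(unit_vec l :: nat \<Rightarrow> 'a) = orbit l"
    using orbit_unit_vec[of l, where 'a='a] by (simp add: fun_eq_iff)
  then have "(shift_op ^^ h) (unit_vec l :: nat \<Rightarrow> 'a) = orbit (l + h)"
    by (simp only: iterate_orbit)
  then show ?thesis
    using False by (simp add: iterated_unit_def fun_eq_iff)
qed

lemma head_expand: "head m x = (\<lambda>k. \<Sum>l<m. x l * unit_vec l k)"
  by (rule ext) (auto simp: head_def unit_vec_def if_distrib sum.If_cases cong: if_cong)

lemma iterate_tail_bound:
  fixes t :: "nat \<Rightarrow> 'a::{real_normed_field, banach}"
  assumes t: "t \<in> koethe \<beta>" "\<And>l. l < start n \<Longrightarrow> t l = 0"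
    and n: "M + 2 \<le> n" and h: "h \<in> {1..start n} \<union> {period n + 1..period n + start n}"
  shows "\<beta> n * seminorm \<beta> M ((shift_op ^^ h) t) \<le> seminorm \<beta> (M + 2) t"
proof -
  obtain c :: real and N where c: "0 \<le> c" "\<And>x :: nat \<Rightarrow> 'a. x \<in> koethe \<beta> \<Longrightarrow> seminorm \<beta> M ((shift_op ^^ h) x) \<le> c * seminorm \<beta> N x"
    using iterate_bound[where 'a='a] by metis
  have main: "\<beta> n * seminorm \<beta> M ((shift_op ^^ h) (head m t)) \<le> seminorm \<beta> (M + 2) t" for m
  proof -
    have "(shift_op ^^ h) (head m t) = (\<lambda>k. \<Sum>l<m. t l * iterated_unit h l k)"
      unfolding head_expand by (subst iterate_sum) (auto simp: unit_vec_in_koethe iterate_unit_vec)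
    then have "seminorm \<beta> M ((shift_op ^^ h) (head m t)) \<le> (\<Sum>l<m. norm (t l) * seminorm \<beta> M (iterated_unit h l :: nat \<Rightarrow> 'a))"
      using koethe_sum[of "{..<m}" "\<lambda>l k. t l * iterated_unit h l k" \<beta> M]
      by (simp add: koethe_cmult iterated_unit_in_koethe)
    then have "\<beta> n * seminorm \<beta> M ((shift_op ^^ h) (head m t))
        \<le> \<beta> n * (\<Sum>l<m. norm (t l) * seminorm \<beta> M (iterated_unit h l :: nat \<Rightarrow> 'a))"
      by (rule mult_left_mono) simp
    also have "\<dots> = (\<Sum>l<m. norm (t l) * (\<beta> n * seminorm \<beta> M (iterated_unit h l :: nat \<Rightarrow> 'a)))"
      by (simp add: sum_distrib_left mult_ac)
    also have "\<dots> \<le> (\<Sum>l<m. norm (t l) * weight \<beta> (M + 2) l)"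
    proof (intro sum_mono)
      fix l
      show "norm (t l) * (\<beta> n * seminorm \<beta> M (iterated_unit h l :: nat \<Rightarrow> 'a)) \<le> norm (t l) * weight \<beta> (M + 2) l"
        using t(2)[of l] iterated_unit_bound[of n l M h, where 'a='a] n h
        by (cases "l < start n") (auto intro!: mult_left_mono)
    qed
    also have "\<dots> \<le> seminorm \<beta> (M + 2) t"
      using seminorm_head_tail[OF t(1), of "M + 2" m] seminorm_nonneg[of \<beta> "M + 2" "tail m t"]
      by (simp add: seminorm_head)
    finally show ?thesis .
  qed
  \<comment> \<open>The estimate holds for the finite heads of \<open>t\<close>; continuity of \<open>shift_op ^^ h\<close> disposes of the rest.\<close>
  have step: "\<beta> n * seminorm \<beta> M ((shift_op ^^ h) t) \<le> seminorm \<beta> (M + 2) t + \<beta> n * (c * seminorm \<beta> N (tail m t))" for m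
  proof -
    have "t = (\<lambda>k. head m t k + tail m t k)"
      by (simp add: tail_eq)
    then have "(shift_op ^^ h) t = (\<lambda>k. (shift_op ^^ h) (head m t) k + (shift_op ^^ h) (tail m t) k)"
      using iterate_add[OF head_in_koethe tail_in_koethe[OF t(1)], of h m t m] by simp
    then have "seminorm \<beta> M ((shift_op ^^ h) t) \<le> seminorm \<beta> M ((shift_op ^^ h) (head m t)) + seminorm \<beta> M ((shift_op ^^ h) (tail m t))"
      using koethe_add(2)[OF iterate_in_koethe[OF head_in_koethe] iterate_in_koethe[OF tail_in_koethe[OF t(1)]], of M h m t h m] by simp
    also have "seminorm \<beta> M ((shift_op ^^ h) (tail m t)) \<le> c * seminorm \<beta> N (tail m t)"
      by (intro c tail_in_koethe t)
    finally have "seminorm \<beta> M ((shift_op ^^ h) t) \<le> seminorm \<beta> M ((shift_op ^^ h) (head m t)) + c * seminorm \<beta> N (tail m t)"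
      by simp
    then have "\<beta> n * seminorm \<beta> M ((shift_op ^^ h) t)
        \<le> \<beta> n * (seminorm \<beta> M ((shift_op ^^ h) (head m t)) + c * seminorm \<beta> N (tail m t))"
      by (rule mult_left_mono) simp
    then show ?thesis
      using main[of m] by (simp add: distrib_left)
  qed
  have "(\<lambda>m. seminorm \<beta> (M + 2) t + \<beta> n * (c * seminorm \<beta> N (tail m t))) \<longlonglongrightarrow> seminorm \<beta> (M + 2) t + \<beta> n * (c * 0)"
    by (intro tendsto_intros seminorm_tail_tendsto t)
  then show ?thesis
    using step by (intro LIMSEQ_le_const[of _ "seminorm \<beta> (M + 2) t"]) auto
qed

end

section \<open>Multiplying a head to the cyclic vector\<close>

text \<open>
  The polynomial \<open>h\<close> of degree less than \<open>N\<close>, that is, \<open>h(T) e\<^sub>0\<close>.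
\<close>

definition orbit_comb :: "nat \<Rightarrow> (nat \<Rightarrow> 'a::real_normed_field) \<Rightarrow> nat \<Rightarrow> 'a" where
  "orbit_comb N h k = (\<Sum>l<N. h l * orbit l k)"

lemma orbit_self [simp]: "orbit l l = 1"
  by (simp add: orbit_def)

lemma orbit_above: "l < k \<Longrightarrow> orbit l k = 0"
  using orbit_support_le[of k l] by (auto simp: orbit_def)

lemma orbit_comb_above: "N \<le> k \<Longrightarrow> orbit_comb N h k = 0"
  unfolding orbit_comb_def by (intro sum.neutral) (auto simp: orbit_above)

lemma orbit_comb_in_koethe: "orbit_comb N h \<in> koethe \<beta>"
  by (rule koethe_finite_support(1)[of "{..<N}"]) (auto simp: orbit_comb_above)

lemma orbit_comb_eq_0D:
  assumes "\<And>k. k < N \<Longrightarrow> orbit_comb N h k = 0" "l < N"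
  shows "h l = 0"
proof (rule ccontr)
  assume "h l \<noteq> 0"
  define A where "A = {l. l < N \<and> h l \<noteq> 0}"
  have A: "finite A" "A \<noteq> {}"
    using assms(2) \<open>h l \<noteq> 0\<close> by (auto simp: A_def)
  define j where "j = Max A"
  have j: "j < N" "h j \<noteq> 0"
    using Max_in[OF A] by (auto simp: j_def A_def)
  have max: "i \<le> j" if "i < N" "h i \<noteq> 0" for i
    unfolding j_def using that A by (intro Max_ge) (auto simp: A_def)
  have "orbit_comb N h j = (\<Sum>i\<in>{j}. h i * orbit i j)"
    unfolding orbit_comb_def
  proof (intro sum.mono_neutral_right)
    show "\<forall>i\<in>{..<N} - {j}. h i * orbit i j = 0"
    proof
      fix i assume "i \<in> {..<N} - {j}"
      then show "h i * orbit i j = 0"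
        using max[of i] orbit_above[of i j, where 'a='a] by (cases "h i = 0") auto
    qed
  qed (use j in auto)
  then show False
    using assms(1)[of j] j by simp
qed

text \<open>
  The orbit vectors form a unitriangular basis.
\<close>

lemma orbit_comb_surj:
  assumes "\<And>k. N \<le> k \<Longrightarrow> y k = 0"
  obtains h where "\<And>l. N \<le> l \<Longrightarrow> h l = 0" "y = orbit_comb N h"
proof -
  have "\<exists>h. (\<forall>l\<ge>N. h l = 0) \<and> y = orbit_comb N h"
    using assms
  proof (induction N arbitrary: y)
    case 0
    then show ?case
      by (intro exI[of _ "\<lambda>_. 0"]) (auto simp: orbit_comb_def fun_eq_iff)
  next
    case (Suc N)
    have "y k - y N * orbit N k = 0" if "N \<le> k" for k
      using that Suc.prems[of k] orbit_above[of N k, where 'a='a] by (cases "k = N") auto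
    then obtain h where h: "\<forall>l\<ge>N. h l = 0" "(\<lambda>k. y k - y N * orbit N k) = orbit_comb N h"
      using Suc.IH[of "\<lambda>k. y k - y N * orbit N k"] by blast
    define h' where "h' = h(N := y N)"
    have "y k = orbit_comb (Suc N) h' k" for k
    proof -
      have "orbit_comb (Suc N) h' k = orbit_comb N h k + y N * orbit N k"
        by (simp add: orbit_comb_def h'_def)
      also have "orbit_comb N h k = y k - y N * orbit N k"
        using fun_cong[OF h(2), of k] by simp
      finally show ?thesis by simp
    qed
    then have "y = orbit_comb (Suc N) h'"
      by (rule ext)
    moreover have "\<forall>l\<ge>Suc N. h' l = 0"
      using h(1) by (simp add: h'_def)
    ultimately show ?case by blast
  qed
  then show thesis using that by blast
qed

lemma orbit_low:
  assumes "l < start (Suc m)" "k < period m"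
  shows "orbit l k = orbit (l mod period m) k"
proof -
  have "orbit_support l = orbit_support (l mod period m) \<union> (\<lambda>q. q * period m + l mod period m) ` {1..l div period m}"
    using orbit_support_block[of "l div period m" m "l mod period m"] assms(1) by simp
  moreover have "k \<notin> (\<lambda>q. q * period m + l mod period m) ` {1..l div period m}"
    using assms(2) by (auto simp: Suc_le_eq dest!: gr0_implies_Suc)
  ultimately show ?thesis
    by (simp add: orbit_def)
qed

lemma orbit_block:
  assumes "l < start (Suc m)" "i < period m" "1 \<le> r"
  shows "orbit l (r * period m + i) = (if l mod period m = i \<and> r \<le> l div period m then 1 else 0)"
proof -
  have orbit_support: "orbit_support l = orbit_support (l mod period m) \<union> (\<lambda>q. q * period m + l mod period m) ` {1..l div period m}"
    using orbit_support_block[of "l div period m" m "l mod period m"] assms(1) by simp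
  have "period m \<le> r * period m + i"
    using assms(3) by (simp add: trans_le_add1)
  then have notin: "r * period m + i \<notin> orbit_support (l mod period m)"
    using orbit_support_le[of "r * period m + i" "l mod period m"] mod_less_divisor[OF period_pos, of l m]
    by (metis leD order.trans)
  have eq: "r * period m + i = q * period m + l mod period m \<longleftrightarrow> r = q \<and> i = l mod period m" for q
  proof
    assume eq: "r * period m + i = q * period m + l mod period m"
    have "(r * period m + i) div period m = (q * period m + l mod period m) div period m"
      "(r * period m + i) mod period m = (q * period m + l mod period m) mod period m"
      using eq by simp_all
    then show "r = q \<and> i = l mod period m"
      using assms(2) by simp
  qed simp
  have mem: "r * period m + i \<in> (\<lambda>q. q * period m + l mod period m) ` {1..l div period m} \<longleftrightarrow> l mod period m = i \<and> r \<le> l div period m"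
    unfolding image_iff eq using assms(3) by auto
  show ?thesis
    using notin mem by (simp add: orbit_def orbit_support)
qed

text \<open>
  Each orbit vector \<open>T\<^sup>l e\<^sub>0\<close> with \<open>l = q C + i\<close>, \<open>q \<ge> s\<close>, has the coordinate \<open>1\<close> at position \<open>i\<close> of
  every block from \<open>1\<close> to \<open>s\<close>, and below \<open>C\<close> it coincides with the orbit vector of index \<open>i\<close>. So block \<open>s\<close>
  records the coefficients of the part below \<open>C\<close>.
\<close>

lemma low_vanishing:
  assumes s: "1 \<le> s" and h: "\<And>l. l < s * period m \<Longrightarrow> h l = 0"
  shows "k < period m \<Longrightarrow> orbit_comb (start (Suc m)) h k = (\<Sum>i<period m. orbit_comb (start (Suc m)) h (s * period m + i) * orbit i k)"
    and "1 \<le> r \<Longrightarrow> r \<le> s \<Longrightarrow> i < period m \<Longrightarrow>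
      orbit_comb (start (Suc m)) h (r * period m + i) = orbit_comb (start (Suc m)) h (s * period m + i)"
proof -
  let ?N = "start (Suc m)"
  have entry: "h l * orbit l (r * period m + i) = (if l mod period m = i then h l else 0)"
    if "l < ?N" "i < period m" "1 \<le> r" "r \<le> s" for l i r
  proof (cases "s * period m \<le> l")
    case True
    then have "s \<le> l div period m"
      by (simp add: less_eq_div_iff_mult_less_eq)
    then show ?thesis
      using that by (simp add: orbit_block)
  qed (use h in auto)
  have block: "orbit_comb ?N h (r * period m + i) = (\<Sum>l<?N. if l mod period m = i then h l else 0)"
    if "i < period m" "1 \<le> r" "r \<le> s" for i r
    unfolding orbit_comb_def using that by (intro sum.cong) (auto simp: entry)
  show "orbit_comb ?N h (r * period m + i) = orbit_comb ?N h (s * period m + i)" if "1 \<le> r" "r \<le> s" "i < period m"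
    using that s by (simp add: block)
  assume k: "k < period m"
  have "(\<Sum>i<period m. orbit_comb ?N h (s * period m + i) * orbit i k)
      = (\<Sum>i<period m. \<Sum>l<?N. if l mod period m = i then h l * orbit i k else 0)"
    using s by (intro sum.cong) (auto simp: block sum_distrib_right intro!: sum.cong)
  also have "\<dots> = (\<Sum>l<?N. \<Sum>i<period m. if l mod period m = i then h l * orbit i k else 0)"
    by (rule sum.swap)
  also have "\<dots> = (\<Sum>l<?N. h l * orbit (l mod period m) k)"
    by (intro sum.cong) auto
  also have "\<dots> = orbit_comb ?N h k"
    unfolding orbit_comb_def using k by (intro sum.cong) (auto simp: orbit_low)
  finally show "orbit_comb ?N h k = (\<Sum>i<period m. orbit_comb ?N h (s * period m + i) * orbit i k)" ..
qed

text \<open>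
  The quantitative form of: the head of \<open>y\<close> is larger than its tail in the next seminorm. It is
  homogeneous and closed. Moreover it does not bound the coordinates in the rows above \<open>M + 1\<close>, which
  are arbitrarily large compared with \<open>m\<close> for a given vector of the space.
\<close>

definition dominant :: "(nat \<Rightarrow> nat) \<Rightarrow> nat \<Rightarrow> nat \<Rightarrow> (nat \<Rightarrow> 'a::real_normed_field) \<Rightarrow> bool" where
  "dominant \<beta> m M y \<longleftrightarrow>
     seminorm \<beta> (Suc M) y \<le> real (Suc m) * (seminorm \<beta> M (head (period m) y) - seminorm \<beta> (Suc M) (tail (period m) y))"

text \<open>
  The product of the polynomials \<open>p\<close> and \<open>h\<close>, truncated after degree \<open>N\<close> and applied to \<open>e\<^sub>0\<close>.
\<close>

definition orbit_conv :: "nat \<Rightarrow> (nat \<Rightarrow> 'a::real_normed_field) \<Rightarrow> (nat \<Rightarrow> 'a) \<Rightarrow> nat \<Rightarrow> 'a" where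
  "orbit_conv N p h k = (\<Sum>j\<le>N. (\<Sum>i\<le>j. p i * h (j - i)) * orbit j k)"

text \<open>
  The size of \<open>p\<close> is measured relative to the seminorm of the vector on which it acts, so that the
  condition survives scaling of \<open>h\<close>. The vanishing of \<open>p 0\<close> excludes the shift by exactly one period.
\<close>

definition solvable :: "(nat \<Rightarrow> nat) \<Rightarrow> nat \<Rightarrow> (nat \<Rightarrow> 'a::real_normed_field) \<Rightarrow> (nat \<Rightarrow> 'a) \<Rightarrow> nat \<Rightarrow> real \<Rightarrow> bool"
  where "solvable \<beta> m h p M B \<longleftrightarrow> p 0 = 0 \<and>
     (\<Sum>i\<le>start (Suc m). norm (p i)) * seminorm \<beta> M (orbit_comb (start (Suc m)) h) \<le> B \<and>
     seminorm \<beta> M (\<lambda>k. orbit_conv (start (Suc m)) p h k - unit_vec 0 k) \<le> 1 / real (Suc m)"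

definition uniformly_solvable :: "'a::real_normed_field itself \<Rightarrow> (nat \<Rightarrow> nat) \<Rightarrow> nat \<Rightarrow> real \<Rightarrow> bool" where
  "uniformly_solvable _ \<beta> m B \<longleftrightarrow> (\<forall>M<m. \<forall>h :: nat \<Rightarrow> 'a.
     (\<forall>l\<ge>start (Suc m). h l = 0) \<longrightarrow> h \<noteq> (\<lambda>_. 0) \<longrightarrow> dominant \<beta> m M (orbit_comb (start (Suc m)) h) \<longrightarrow>
     (\<exists>p. solvable \<beta> m h p M B))"

lemma solvable_mono:
  "solvable \<beta> m h p M B \<Longrightarrow> B \<le> B' \<Longrightarrow> solvable \<beta> m h p M B'"
  unfolding solvable_def by linarith

lemma uniformly_solvable_mono:
  assumes "uniformly_solvable TYPE('a::real_normed_field) \<beta> m B" "B \<le> B'"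
  shows "uniformly_solvable TYPE('a) \<beta> m B'"
  unfolding uniformly_solvable_def
proof (intro allI impI)
  fix M and h :: "nat \<Rightarrow> 'a"
  assume "M < m" "\<forall>l\<ge>start (Suc m). h l = 0" "h \<noteq> (\<lambda>_. 0)" "dominant \<beta> m M (orbit_comb (start (Suc m)) h)"
  then obtain p where "solvable \<beta> m h p M B"
    using assms(1) unfolding uniformly_solvable_def by blast
  then show "\<exists>p. solvable \<beta> m h p M B'"
    using solvable_mono assms(2) by blast
qed

lemma orbit_conv_above: "N < k \<Longrightarrow> orbit_conv N p h k = 0"
  unfolding orbit_conv_def by (intro sum.neutral) (auto simp: orbit_above)

lemma orbit_conv_in_koethe: "(\<lambda>k. orbit_conv N p h k - unit_vec 0 k) \<in> koethe \<beta>"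
  and seminorm_orbit_conv: "seminorm \<beta> M (\<lambda>k. orbit_conv N p h k - unit_vec 0 k) =
    (\<Sum>k\<le>N. norm (orbit_conv N p h k - unit_vec 0 k) * weight \<beta> M k)"
  using koethe_finite_support[of "{..N}" "\<lambda>k. orbit_conv N p h k - unit_vec 0 k" \<beta>]
  by (auto simp: orbit_conv_above unit_vec_def)

lemma seminorm_orbit_comb:
  "seminorm \<beta> M (orbit_comb N h) = (\<Sum>k<N. norm (orbit_comb N h k) * weight \<beta> M k)"
  by (rule koethe_finite_support(2)) (auto simp: orbit_comb_above)

lemma seminorm_tail_orbit_comb:
  "seminorm \<beta> M (tail c (orbit_comb N h)) = (\<Sum>k\<in>{c..<N}. norm (orbit_comb N h k) * weight \<beta> M k)"
proof -
  have "seminorm \<beta> M (tail c (orbit_comb N h)) = (\<Sum>k\<in>{c..<N}. norm (tail c (orbit_comb N h) k) * weight \<beta> M k)"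
    by (rule koethe_finite_support(2)) (auto simp: orbit_comb_above tail_def)
  then show ?thesis by (simp add: tail_def)
qed

text \<open>
  All vectors involved live on the indices up to \<open>start (Suc m)\<close>; this is why \<open>\<beta> (Suc m)\<close> can be chosen
  in dependence on a solution.
\<close>

lemma uniformly_solvable_cong:
  assumes "\<And>k. k \<le> m \<Longrightarrow> \<beta> k = \<beta>' k"
  shows "uniformly_solvable TYPE('a::real_normed_field) \<beta> m B \<longleftrightarrow> uniformly_solvable TYPE('a) \<beta>' m B"
proof -
  have weight: "weight \<beta> M l = weight \<beta>' M l" if "l \<le> start (Suc m)" for M l
    using that assms by (intro weight_cong[of "Suc m"]) auto
  have "period m < start (Suc m)"
    by (rule period_less_start)
  then show ?thesis
    unfolding uniformly_solvable_def solvable_def dominant_def seminorm_orbit_comb seminorm_tail_orbit_comb seminorm_orbit_conv seminorm_head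
    by (simp add: weight cong: sum.cong_simp)
qed

context
  fixes \<beta> :: "nat \<Rightarrow> nat" and m :: nat
  assumes large_at: "large_at \<beta> m (\<beta> m)"
begin

lemma block_less:
  assumes "r \<le> Suc m" "i < period m"
  shows "r * period m + i < start (Suc m)"
proof -
  have "r * period m + i < Suc r * period m"
    using assms by simp
  also have "\<dots> \<le> start (Suc m)"
    using assms unfolding start_Suc by (intro mult_right_mono) auto
  finally show ?thesis .
qed

text \<open>
  By \<open>low_vanishing\<close> the head is a combination of orbit vectors below the period whose coefficients are
  the coordinates in block \<open>m - M\<close>. That block lies in row \<open>M + 1\<close>, and its weights exceed the seminorms of
  these orbit vectors.
\<close>

lemma head_le_tail:
  assumes M: "M < m" and h: "\<And>l. l < (m - M) * period m \<Longrightarrow> h l = 0"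
  shows "seminorm \<beta> M (head (period m) (orbit_comb (start (Suc m)) h)) \<le> seminorm \<beta> (Suc M) (tail (period m) (orbit_comb (start (Suc m)) h))"
proof -
  let ?s = "m - M" and ?u = "orbit_comb (start (Suc m)) h"
  have s: "1 \<le> ?s" "?s \<le> Suc m" using M by auto
  have orbit_weight_le: "orbit_weight \<beta> M i \<le> weight \<beta> (Suc M) (?s * period m + i)" if "i < period m" for i
  proof -
    have "2 * \<beta> m * orbit_weight \<beta> M i \<le> \<beta> m ^ (2 * M + 2)"
      using that M period_less_start[of m] by (intro orbit_weight_bound[OF large_at]) auto
    moreover have "1 * orbit_weight \<beta> M i \<le> 2 * \<beta> m * orbit_weight \<beta> M i"
      using beta_pos[OF large_at] by (intro mult_right_mono) auto
    moreover have "\<beta> m ^ (2 * Suc M) \<le> weight \<beta> (Suc M) (?s * period m + i)"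
    proof (rule weight_lower[OF large_at])
      show "start m < ?s * period m + i"
        using s start_less_period[of m] mult_le_mono1[OF s(1), of "period m"] by linarith
      show "?s * period m + i < start (Suc m)"
        using s(2) that by (rule block_less)
      show "row (?s * period m + i) \<le> Suc M"
        using row_block[OF s that] M by simp
    qed
    moreover have "2 * Suc M = 2 * M + 2"
      by simp
    ultimately show ?thesis
      by (metis mult_1 order_trans)
  qed
  have "seminorm \<beta> M (head (period m) ?u) = (\<Sum>k<period m. norm (\<Sum>i<period m. ?u (?s * period m + i) * orbit i k) * weight \<beta> M k)"
    unfolding seminorm_head using low_vanishing(1)[of ?s m h] s(1) h by (intro sum.cong) auto
  also have "\<dots> \<le> (\<Sum>k<period m. (\<Sum>i<period m. norm (?u (?s * period m + i)) * norm (orbit i k :: 'a)) * weight \<beta> M k)"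
    by (intro sum_mono mult_right_mono order_trans[OF norm_sum]) (auto simp: norm_mult)
  also have "\<dots> = (\<Sum>i<period m. norm (?u (?s * period m + i)) * (\<Sum>k<period m. norm (orbit i k :: 'a) * weight \<beta> M k))"
    unfolding sum_distrib_right sum_distrib_left by (subst sum.swap) (simp add: mult.assoc)
  also have "\<dots> \<le> (\<Sum>i<period m. norm (?u (?s * period m + i)) * weight \<beta> (Suc M) (?s * period m + i))"
  proof (intro sum_mono mult_left_mono)
    fix i assume i: "i \<in> {..<period m}"
    have "(\<Sum>k<period m. norm (orbit i k :: 'a) * weight \<beta> M k) = seminorm \<beta> M (orbit i :: nat \<Rightarrow> 'a)"
      using i by (intro koethe_finite_support(2)[symmetric]) (auto simp: orbit_above)
    then show "(\<Sum>k<period m. norm (orbit i k :: 'a) * weight \<beta> M k) \<le> weight \<beta> (Suc M) (?s * period m + i)"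
      using orbit_weight_le[of i] i by (simp add: seminorm_orbit)
  qed auto
  also have "\<dots> = (\<Sum>k\<in>(\<lambda>i. ?s * period m + i) ` {..<period m}. norm (?u k) * weight \<beta> (Suc M) k)"
    by (subst sum.reindex) (auto simp: inj_on_def)
  also have "\<dots> \<le> seminorm \<beta> (Suc M) (tail (period m) ?u)"
    unfolding seminorm_tail_orbit_comb
  proof (intro sum_mono2)
    have "period m \<le> ?s * period m"
      using mult_le_mono1[OF s(1), of "period m"] by (simp only: mult_1)
    then have "period m \<le> ?s * period m + i" for i
      by (rule trans_le_add1)
    then show "(\<lambda>i. ?s * period m + i) ` {..<period m} \<subseteq> {period m..<start (Suc m)}"
      using block_less[OF s(2)] unfolding image_subset_iff atLeastLessThan_iff by blast
  qed auto
  finally show ?thesis .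
qed

text \<open>
  Otherwise the tail would dominate the head, and dominance would force the seminorm \<open>M + 1\<close> to vanish.
  The block in row \<open>M + 1\<close> would then be zero; it determines the preceding blocks and the part below the period,
  while the following blocks are visible themselves. So the vector would vanish.
\<close>

lemma dominant_imp_low:
  assumes M: "M < m" and supp: "\<And>l. start (Suc m) \<le> l \<Longrightarrow> h l = 0" and nz: "h \<noteq> (\<lambda>_. 0)"
    and dom: "dominant \<beta> m M (orbit_comb (start (Suc m)) h)"
  shows "\<exists>l<(m - M) * period m. h l \<noteq> 0"
proof (rule ccontr)
  let ?s = "m - M" and ?u = "orbit_comb (start (Suc m)) h"
  have s: "1 \<le> ?s" using M by auto
  assume "\<not> (\<exists>l<?s * period m. h l \<noteq> 0)"
  then have low: "h l = 0" if "l < ?s * period m" for l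
    using that by auto
  have "seminorm \<beta> M (head (period m) ?u) - seminorm \<beta> (Suc M) (tail (period m) ?u) \<le> 0"
    using head_le_tail[OF M low] by simp
  then have "real (Suc m) * (seminorm \<beta> M (head (period m) ?u) - seminorm \<beta> (Suc M) (tail (period m) ?u)) \<le> 0"
    by (intro mult_nonneg_nonpos) auto
  then have "seminorm \<beta> (Suc M) ?u = 0"
    using dom seminorm_nonneg[of \<beta> "Suc M" ?u] unfolding dominant_def by linarith
  then have "\<forall>k<start (Suc m). norm (?u k) * weight \<beta> (Suc M) k = 0"
    unfolding seminorm_orbit_comb by (subst (asm) sum_nonneg_eq_0_iff) auto
  then have vis: "?u k = 0" if "k < start (Suc m)" "row k \<le> Suc M" for k
    using that weight_ge_1[of k "Suc M" \<beta>] by force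
  have u_s: "?u (?s * period m + i) = 0" if "i < period m" for i
    using that M s row_block[of ?s m i] by (intro vis block_less) auto
  have "?u k = 0" if k: "k < start (Suc m)" for k
  proof -
    define r i where "r = k div period m" and "i = k mod period m"
    have kri: "k = r * period m + i" and i: "i < period m"
      by (auto simp: r_def i_def)
    have r: "r \<le> Suc m"
      using k unfolding r_def start_Suc by (simp add: div_less_iff_less_mult less_Suc_eq_le[symmetric])
    consider "r = 0" | "1 \<le> r" "r \<le> ?s" | "?s < r"
      by linarith
    then show ?thesis
    proof cases
      case 1
      then show ?thesis
        using low_vanishing(1)[of ?s m h k] s low kri i u_s by simp
    next
      case 2
      then show ?thesis
        using low_vanishing(2)[of ?s m h r i] s low i u_s[OF i] kri by simp
    next
      case 3
      then show ?thesis
        using vis[OF k] row_block[of r m i] r i kri by simp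
    qed
  qed
  then have "h l = 0" for l
    using orbit_comb_eq_0D[of "start (Suc m)" h l] supp[of l] by (cases "l < start (Suc m)") auto
  then show False
    using nz by auto
qed

text \<open>
  The monomial of degree \<open>(m - M) C\<close> equals \<open>e\<^sub>0\<close> plus basis vectors from the blocks up to \<open>m - M\<close>, which lie
  in rows above \<open>M\<close>.
\<close>

lemma exact_solution:
  assumes M: "M < m" and l: "l < (m - M) * period m" "h l \<noteq> 0"
  obtains p :: "nat \<Rightarrow> 'a::real_normed_field"
  where "p 0 = 0" "seminorm \<beta> M (\<lambda>k. orbit_conv (start (Suc m)) p h k - unit_vec 0 k) = 0"
proof -
  let ?s = "m - M"
  \<comment> \<open>The lowest term of \<open>h\<close> comes before degree \<open>?s * period m\<close>, so the power series \<open>h\<close> divides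
    the monomial of that degree; the quotient has positive order, hence \<open>p 0 = 0\<close>.\<close>
  define f where "f = Abs_fps h"
  have sub: "subdegree f \<le> l"
    using l by (intro subdegree_leI) (simp add: f_def)
  have f0: "f \<noteq> 0"
    using l by (auto simp: f_def fps_eq_iff)
  have "f dvd fps_X ^ (?s * period m)"
    using f0 sub l by (simp add: fps_dvd_iff fps_X_power_subdegree)
  then obtain q where q: "fps_X ^ (?s * period m) = f * q"
    by (auto simp: dvd_def)
  have nz: "q \<noteq> 0"
    using q by auto
  have "?s * period m = subdegree f + subdegree q"
    using f0 nz arg_cong[OF q, of subdegree] by (simp add: fps_X_power_subdegree)
  then have "0 < subdegree q"
    using sub l by simp
  then have q0: "fps_nth q 0 = 0"
    by (rule nth_less_subdegree_zero)
  have coeff: "(\<Sum>i\<le>j. fps_nth q i * h (j - i)) = (if j = ?s * period m then 1 else 0)" for j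
  proof -
    have "(\<Sum>i\<le>j. fps_nth q i * h (j - i)) = fps_nth (q * f) j"
      by (simp add: fps_mult_nth f_def atLeast0AtMost)
    also have "q * f = fps_X ^ (?s * period m)"
      using q by (simp add: mult.commute)
    finally show ?thesis
      by simp
  qed
  have sF: "?s * period m < start (Suc m)"
    using block_less[of ?s 0] M by simp
  have "orbit_conv (start (Suc m)) (fps_nth q) h k = orbit (?s * period m) k" for k
    unfolding orbit_conv_def coeff using sF by (simp add: if_distrib[of "\<lambda>x. x * _"] sum.delta cong: if_cong)
  moreover have "(orbit (?s * period m) k - unit_vec 0 k :: 'a) = 0 \<or> weight \<beta> M k = 0" for k
  proof -
    have "orbit_support 0 = {0}"
      using orbit_support_le[of _ 0] by auto
    then have orbit_support: "orbit_support (?s * period m) = {0} \<union> (\<lambda>q. q * period m) ` {1..?s}"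
      using orbit_support_block[of ?s m 0] sF by simp
    show ?thesis
    proof (cases "k \<in> (\<lambda>q. q * period m) ` {1..?s}")
      case True
      then obtain r where r: "1 \<le> r" "r \<le> ?s" "k = r * period m"
        by auto
      then have "row k = Suc m - r"
        using row_block[of r m 0] M by simp
      then have "M < row k"
        using r M by linarith
      then show ?thesis
        by (simp add: weight_def)
    next
      case False
      then show ?thesis
        by (auto simp: orbit_def orbit_support unit_vec_def)
    qed
  qed
  ultimately have "seminorm \<beta> M (\<lambda>k. orbit_conv (start (Suc m)) (fps_nth q) h k - unit_vec 0 k) = 0"
    unfolding seminorm_def by (intro infsum_0) auto
  with q0 show thesis by (rule that)
qed

end

lemma compact_box:
  "compact {h :: nat \<Rightarrow> 'a::{real_normed_field, heine_borel}. (\<forall>l\<ge>N. h l = 0) \<and> (\<forall>l<N. norm (h l) \<le> 1)}"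
proof -
  have "compact (Pi\<^sub>E UNIV (\<lambda>l. if l < N then cball 0 1 else {0} :: 'a set))"
    using compactin_PiE[of "\<lambda>_. euclidean" UNIV "\<lambda>l. if l < N then cball 0 1 else {0} :: 'a set"]
    by (simp add: euclidean_product_topology)
  also have "Pi\<^sub>E UNIV (\<lambda>l. if l < N then cball 0 1 else {0} :: 'a set)
      = {h. \<forall>l. (l < N \<longrightarrow> norm (h l) \<le> 1) \<and> (\<not> l < N \<longrightarrow> h l = 0)}"
    by (intro set_eqI) (simp add: PiE_iff if_split[of "\<lambda>A. _ \<in> A"])
  also have "\<dots> = {h. (\<forall>l\<ge>N. h l = 0) \<and> (\<forall>l<N. norm (h l) \<le> 1)}"
    by (auto simp: not_less)
  finally show ?thesis .
qed

lemma continuous_on_orbit_comb [continuous_intros]: "continuous_on A (\<lambda>h. orbit_comb N h k)"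
  unfolding orbit_comb_def
  by (intro continuous_intros continuous_on_subset[OF continuous_on_product_coordinates]) auto

lemma continuous_on_orbit_conv [continuous_intros]:
  "continuous_on A (\<lambda>h. orbit_conv N p h k)"
  unfolding orbit_conv_def
  by (intro continuous_intros continuous_on_subset[OF continuous_on_product_coordinates]) auto

lemma orbit_comb_scale: "orbit_comb N (\<lambda>l. a * h l) = (\<lambda>k. a * orbit_comb N h k)"
  by (simp add: orbit_comb_def fun_eq_iff sum_distrib_left mult.assoc)

lemma orbit_conv_scale:
  "orbit_conv N (\<lambda>i. p i * a) h k = orbit_conv N p (\<lambda>l. a * h l) k"
  by (simp add: orbit_conv_def mult_ac)

lemma seminorm_orbit_comb_scale:
  "seminorm \<beta> M (orbit_comb N (\<lambda>l. a * h l)) = norm a * seminorm \<beta> M (orbit_comb N h)"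
  by (simp add: orbit_comb_scale koethe_cmult orbit_comb_in_koethe)

lemma dominant_scale:
  assumes "y \<in> koethe \<beta>" "dominant \<beta> m M y"
  shows "dominant \<beta> m M (\<lambda>k. a * y k)"
proof -
  have "head (period m) (\<lambda>k. a * y k) = (\<lambda>k. a * head (period m) y k)"
    "tail (period m) (\<lambda>k. a * y k) = (\<lambda>k. a * tail (period m) y k)"
    by (auto simp: head_def tail_def)
  then show ?thesis
    using mult_left_mono[OF assms(2)[unfolded dominant_def], of "norm a"] assms(1)
    by (simp add: dominant_def koethe_cmult head_in_koethe tail_in_koethe algebra_simps)
qed

text \<open>
  An exact solution for one polynomial is an approximate solution for all nearby ones, so finitely many
  solutions serve the whole compact set of dominant polynomials on the unit sphere.
\<close>

lemma uniformly_solvable_exists: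
  assumes large_at: "large_at \<beta> m (\<beta> m)"
  obtains B where "uniformly_solvable TYPE('a::{real_normed_field, heine_borel}) \<beta> m B"
proof -
  let ?N = "start (Suc m)"
  have "\<exists>B\<ge>0. \<forall>h :: nat \<Rightarrow> 'a. (\<forall>l\<ge>?N. h l = 0) \<longrightarrow> h \<noteq> (\<lambda>_. 0) \<longrightarrow>
      dominant \<beta> m M (orbit_comb ?N h) \<longrightarrow> (\<exists>p. solvable \<beta> m h p M B)" if M: "M < m" for M
  proof -
    \<comment> \<open>Dominance is invariant under scaling, so a sphere suffices, and on it dominance is a compact condition.\<close>
    define K where "K = {h :: nat \<Rightarrow> 'a. (\<forall>l\<ge>?N. h l = 0) \<and> (\<forall>l<?N. norm (h l) \<le> 1)}
      \<inter> {h. (\<Sum>l<?N. norm (h l)) = 1} \<inter> {h. dominant \<beta> m M (orbit_comb ?N h)}"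
    have coord: "continuous_on UNIV (\<lambda>h :: nat \<Rightarrow> 'a. h l)" for l
      by (rule continuous_on_product_coordinates)
    have "closed {h :: nat \<Rightarrow> 'a. (\<Sum>l<?N. norm (h l)) = 1}"
      by (intro closed_Collect_eq continuous_intros coord)
    moreover have "closed {h :: nat \<Rightarrow> 'a. dominant \<beta> m M (orbit_comb ?N h)}"
      unfolding dominant_def seminorm_orbit_comb seminorm_head seminorm_tail_orbit_comb
      by (intro closed_Collect_le continuous_intros)
    ultimately have "compact K"
      unfolding K_def by (intro compact_Int_closed compact_box)
    define P where "P = {p :: nat \<Rightarrow> 'a. p 0 = 0}"
    define U where "U p = {h. seminorm \<beta> M (\<lambda>k. orbit_conv ?N p h k - unit_vec 0 k) < 1 / real (Suc m)}" for p :: "nat \<Rightarrow> 'a"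
    have "open (U p)" for p
      unfolding U_def seminorm_orbit_conv by (intro open_Collect_less continuous_intros)
    moreover have "K \<subseteq> (\<Union>p\<in>P. U p)"
    proof
      fix h assume h: "h \<in> K"
      then have "h \<noteq> (\<lambda>_. 0)"
        by (auto simp: K_def)
      then obtain l where "l < (m - M) * period m" "h l \<noteq> 0"
        using dominant_imp_low[OF large_at M, of h] h by (auto simp: K_def)
      then obtain p where "p 0 = 0" "seminorm \<beta> M (\<lambda>k. orbit_conv ?N p h k - unit_vec 0 k) = 0"
        using exact_solution[OF large_at M, of l h] by blast
      then show "h \<in> (\<Union>p\<in>P. U p)"
        by (auto simp: P_def U_def)
    qed
    ultimately obtain P' where P': "P' \<subseteq> P" "finite P'" "K \<subseteq> (\<Union>p\<in>P'. U p)"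
      using compactE_image[OF \<open>compact K\<close>, of P U] by blast
    define A where "A = (\<Sum>p\<in>P'. \<Sum>i\<le>?N. norm (p i))"
    define D where "D = (\<Sum>l<?N. real (orbit_weight \<beta> M l))"
    have nonneg: "0 \<le> A" "0 \<le> D"
      by (auto simp: A_def D_def intro!: sum_nonneg)
    have "\<exists>p. solvable \<beta> m h p M (A * D)"
      if supp: "\<forall>l\<ge>?N. h l = 0" and nz: "h \<noteq> (\<lambda>_. 0)" and dom: "dominant \<beta> m M (orbit_comb ?N h)"
      for h :: "nat \<Rightarrow> 'a"
    proof -
      define t where "t = (\<Sum>l<?N. norm (h l))"
      obtain l where l: "h l \<noteq> 0" using nz by auto
      then have lN: "l < ?N" using supp not_le by blast
      have "0 < norm (h l)" using l by simp
      also have "norm (h l) \<le> t"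
        unfolding t_def using lN by (intro member_le_sum) auto
      finally have t: "0 < t" .
      \<comment> \<open>Dividing the solution by the norm of \<open>h\<close> costs nothing: the bound is on its product with a seminorm of \<open>h\<close>.\<close>
      define a :: 'a where "a = of_real (1 / t)"
      have a: "norm a = 1 / t" using t by (simp add: a_def norm_divide)
      define h' where "h' = (\<lambda>l. a * h l)"
      have "norm (h l) \<le> t" if "l < ?N" for l
        unfolding t_def using that by (intro member_le_sum) auto
      then have 1: "\<forall>l<?N. norm (h' l) \<le> 1"
        using t by (simp add: h'_def norm_mult a)
      have 2: "(\<Sum>l<?N. norm (h' l)) = 1"
        using t by (simp add: h'_def norm_mult a t_def flip: sum_divide_distrib)
      have "h' \<in> K"
        unfolding K_def using 1 2 supp dominant_scale[OF orbit_comb_in_koethe dom, of a]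
        by (auto simp: h'_def orbit_comb_scale)
      then obtain p where p: "p \<in> P'" "h' \<in> U p"
        using P' by blast
      have pA: "(\<Sum>i\<le>?N. norm (p i)) \<le> A"
        unfolding A_def using p P' by (intro member_le_sum) (auto intro!: sum_nonneg)
      have "seminorm \<beta> M (orbit_comb ?N h') \<le> (\<Sum>l<?N. seminorm \<beta> M (\<lambda>k. h' l * orbit l k))"
        unfolding orbit_comb_def[abs_def]
        using koethe_sum[of "{..<?N}" "\<lambda>l k. h' l * orbit l k" \<beta> M] by (simp add: koethe_cmult orbit_in_koethe)
      also have "\<dots> = (\<Sum>l<?N. norm (h' l) * orbit_weight \<beta> M l)"
        by (simp add: koethe_cmult orbit_in_koethe seminorm_orbit)
      also have "\<dots> \<le> (\<Sum>l<?N. 1 * real (orbit_weight \<beta> M l))"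
        using 1 by (intro sum_mono mult_right_mono) auto
      finally have pD: "seminorm \<beta> M (orbit_comb ?N h') \<le> D"
        by (simp add: D_def)
      have "solvable \<beta> m h (\<lambda>i. p i * a) M (A * D)"
        unfolding solvable_def
      proof (intro conjI)
        show "p 0 * a = 0"
          using p P' by (auto simp: P_def)
        have "(\<Sum>i\<le>?N. norm (p i * a)) * seminorm \<beta> M (orbit_comb ?N h) = (\<Sum>i\<le>?N. norm (p i)) * seminorm \<beta> M (orbit_comb ?N h')"
          by (simp add: h'_def seminorm_orbit_comb_scale norm_mult flip: sum_distrib_right)
        also have "\<dots> \<le> A * D"
          using pA pD nonneg seminorm_nonneg by (intro mult_mono) auto
        finally show "(\<Sum>i\<le>?N. norm (p i * a)) * seminorm \<beta> M (orbit_comb ?N h) \<le> A * D" .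
        show "seminorm \<beta> M (\<lambda>k. orbit_conv ?N (\<lambda>i. p i * a) h k - unit_vec 0 k) \<le> 1 / real (Suc m)"
          using p(2) orbit_conv_scale[where a = a] by (simp add: U_def h'_def)
      qed
      then show ?thesis by blast
    qed
    then show ?thesis
      using nonneg by (intro exI[of _ "A * D"]) auto
  qed
  then obtain B where B: "\<And>M. M < m \<Longrightarrow> 0 \<le> B M \<and> (\<forall>h :: nat \<Rightarrow> 'a. (\<forall>l\<ge>?N. h l = 0) \<longrightarrow>
      h \<noteq> (\<lambda>_. 0) \<longrightarrow> dominant \<beta> m M (orbit_comb ?N h) \<longrightarrow> (\<exists>p. solvable \<beta> m h p M (B M)))"
    by metis
  have le: "B M \<le> (\<Sum>M<m. B M)" if "M < m" for M
    using that B by (intro member_le_sum) auto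
  have "uniformly_solvable TYPE('a) \<beta> m (\<Sum>M<m. B M)"
    unfolding uniformly_solvable_def
  proof (intro allI impI)
    fix M and h :: "nat \<Rightarrow> 'a"
    assume "M < m" "\<forall>l\<ge>?N. h l = 0" "h \<noteq> (\<lambda>_. 0)" "dominant \<beta> m M (orbit_comb ?N h)"
    then obtain p where "solvable \<beta> m h p M (B M)"
      using B by blast
    then have "solvable \<beta> m h p M (\<Sum>M<m. B M)"
      using le[OF \<open>M < m\<close>] by (rule solvable_mono)
    then show "\<exists>p. solvable \<beta> m h p M (\<Sum>M<m. B M)" by blast
  qed
  then show thesis by (rule that)
qed

lemma large_at_cong:
  assumes "\<And>k. k < n \<Longrightarrow> \<beta> k = \<beta>' k"
  shows "large_at \<beta> n b \<longleftrightarrow> large_at \<beta>' n b"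
  using assms orbit_weight_cong[of n \<beta> \<beta>'] by (simp add: large_at_def)

lemma large_at_exists: "\<exists>b0. \<forall>b\<ge>b0. large_at \<beta> n b"
proof -
  let ?f = "\<lambda>N k. 2 * (orbit_weight \<beta> N k + (n + 2) * 6 ^ n + (2 * n + 3) ^ n)"
  define b0 where "b0 = start (Suc n) + (\<Sum>k<n. \<beta> k) + (\<Sum>(N, k)\<in>{..n} \<times> {..start n}. ?f N k)"
  have "\<beta> k \<le> b0" if "k < n" for k
    using member_le_sum[of k "{..<n}" \<beta>] that by (simp add: b0_def)
  moreover have "?f N k \<le> b0" if "N \<le> n" "k \<le> start n" for N k
    using member_le_sum[of "(N, k)" "{..n} \<times> {..start n}" "\<lambda>(N, k). ?f N k"] that by (simp add: b0_def)
  ultimately have "large_at \<beta> n b" if "b0 \<le> b" for b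
    unfolding large_at_def using that by (auto simp: b0_def intro: order_trans)
  then show ?thesis by blast
qed

text \<open>
  The values are chosen one after the other; the bound on the solutions for stage \<open>m\<close> is known when
  \<open>\<beta> (Suc m)\<close> is chosen.
\<close>

theorem weights_exist:
  obtains \<beta> where "\<And>n. large_at \<beta> n (\<beta> n)"
    "\<And>m. uniformly_solvable TYPE('a::{real_normed_field, heine_borel}) \<beta> m (\<beta> (Suc m))"
proof -
  define Q where "Q \<beta> n b \<longleftrightarrow> large_at \<beta> n b \<and> (\<forall>m. n = Suc m \<longrightarrow> uniformly_solvable TYPE('a) \<beta> m (real b))"
    for \<beta> n b
  have "\<exists>\<beta>. \<forall>n. Q \<beta> n (\<beta> n)"
  proof (rule dependent_wellorder_choice)
    fix r and f g :: "nat \<Rightarrow> nat" and n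
    assume eq: "\<And>k. k < n \<Longrightarrow> f k = g k"
    have "uniformly_solvable TYPE('a) f m (real r) \<longleftrightarrow> uniformly_solvable TYPE('a) g m (real r)" if "n = Suc m" for m
      using eq that by (intro uniformly_solvable_cong) auto
    then show "Q f n r = Q g n r"
      using large_at_cong[of n f g r] eq by (auto simp: Q_def)
  next
    fix n and f :: "nat \<Rightarrow> nat"
    assume prev: "\<And>k. k < n \<Longrightarrow> Q f k (f k)"
    obtain b0 where b0: "\<And>b. b0 \<le> b \<Longrightarrow> large_at f n b"
      using large_at_exists by blast
    show "\<exists>r. Q f n r"
    proof (cases n)
      case 0
      then show ?thesis
        using b0 by (auto simp: Q_def)
    next
      case (Suc m)
      then have "large_at f m (f m)"
        using prev[of m] by (simp add: Q_def)
      then obtain B where B: "uniformly_solvable TYPE('a) f m B"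
        by (rule uniformly_solvable_exists)
      define b where "b = max b0 (nat \<lceil>B\<rceil>)"
      have "B \<le> real b"
        unfolding b_def by linarith
      then have "uniformly_solvable TYPE('a) f m (real b)"
        using B uniformly_solvable_mono by blast
      moreover have "large_at f n b"
        by (intro b0) (simp add: b_def)
      ultimately show ?thesis
        using Suc by (auto simp: Q_def)
    qed
  qed
  then obtain \<beta> where "\<And>n. Q \<beta> n (\<beta> n)" by blast
  then show thesis
    by (intro that[of \<beta>]) (auto simp: Q_def)
qed

section \<open>All nonzero vectors are cyclic\<close>

text \<open>
  The operator \<open>p(T) T\<^sup>c\<close>.
\<close>

definition poly_at :: "nat \<Rightarrow> nat \<Rightarrow> (nat \<Rightarrow> 'a::real_normed_field) \<Rightarrow> (nat \<Rightarrow> 'a) \<Rightarrow> nat \<Rightarrow> 'a" where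
  "poly_at c N p x k = (\<Sum>i\<le>N. p i * (shift_op ^^ (c + i)) x k)"

lemma orbit_weight_invisible_le:
  assumes "M < n" "start n < k" "k \<le> 2 * start n"
  shows "orbit_weight \<beta> M k = 0"
  using assms by (intro orbit_weight_invisible) auto

context fast_weights
begin

lemma poly_at_in_koethe:
  fixes x :: "nat \<Rightarrow> 'a::{real_normed_field, banach}"
  shows "x \<in> koethe \<beta> \<Longrightarrow> poly_at c N p x \<in> koethe \<beta>"
  unfolding poly_at_def[abs_def]
  using koethe_sum[of "{..N}" "\<lambda>i k. p i * (shift_op ^^ (c + i)) x k" \<beta>] by (simp add: koethe_cmult iterate_in_koethe)

lemma poly_at_add:
  fixes x y :: "nat \<Rightarrow> 'a::{real_normed_field, banach}"
  assumes "x \<in> koethe \<beta>" "y \<in> koethe \<beta>"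
  shows "poly_at c N p (\<lambda>k. x k + y k) = (\<lambda>k. poly_at c N p x k + poly_at c N p y k)"
  using assms by (simp add: poly_at_def fun_eq_iff iterate_add distrib_left sum.distrib)

lemma poly_at_tail:
  fixes t :: "nat \<Rightarrow> 'a::{real_normed_field, banach}"
  assumes t: "t \<in> koethe \<beta>" "\<And>l. l < start n \<Longrightarrow> t l = 0" and M: "M + 2 \<le> n" and p0: "p 0 = 0"
  shows "\<beta> n * seminorm \<beta> M (poly_at (period n) (start n) p t) \<le> (\<Sum>i\<le>start n. norm (p i)) * seminorm \<beta> (M + 2) t"
proof -
  have "seminorm \<beta> M (poly_at (period n) (start n) p t) \<le> (\<Sum>i\<le>start n. norm (p i) * seminorm \<beta> M ((shift_op ^^ (period n + i)) t))"
    unfolding poly_at_def[abs_def]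
    using koethe_sum[of "{..start n}" "\<lambda>i k. p i * (shift_op ^^ (period n + i)) t k" \<beta> M] t
    by (simp add: koethe_cmult iterate_in_koethe)
  then have "\<beta> n * seminorm \<beta> M (poly_at (period n) (start n) p t)
      \<le> \<beta> n * (\<Sum>i\<le>start n. norm (p i) * seminorm \<beta> M ((shift_op ^^ (period n + i)) t))"
    by (rule mult_left_mono) simp
  also have "\<dots> = (\<Sum>i\<le>start n. norm (p i) * (\<beta> n * seminorm \<beta> M ((shift_op ^^ (period n + i)) t)))"
    by (simp add: sum_distrib_left mult_ac)
  also have "\<dots> \<le> (\<Sum>i\<le>start n. norm (p i) * seminorm \<beta> (M + 2) t)"
  proof (intro sum_mono)
    fix i assume i: "i \<in> {..start n}"
    show "norm (p i) * (\<beta> n * seminorm \<beta> M ((shift_op ^^ (period n + i)) t)) \<le> norm (p i) * seminorm \<beta> (M + 2) t"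
    proof (cases "i = 0")
      case False
      then have "period n + i \<in> {1..start n} \<union> {period n + 1..period n + start n}"
        using i by auto
      then show ?thesis
        by (intro mult_left_mono iterate_tail_bound t M) auto
    qed (simp add: p0)
  qed
  finally show ?thesis
    by (simp add: sum_distrib_right)
qed

text \<open>
  In row \<open>n\<close> everything is invisible here: the difference between the orbit vectors with indices \<open>C + k\<close>
  and \<open>k\<close>, and the orbit vectors with indices \<open>k\<close> between \<open>start n\<close> and \<open>2 * start n\<close>, which
  are the terms dropped in the truncated product.
\<close>

lemma poly_at_orbit_comb:
  fixes h :: "nat \<Rightarrow> 'a::{real_normed_field, banach}"
  assumes M: "M < n" and h: "\<And>l. start n \<le> l \<Longrightarrow> h l = 0"
  shows "seminorm \<beta> M (\<lambda>k. poly_at (period n) (start n) p (orbit_comb (start n) h) k - orbit_conv (start n) p h k) = 0"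
proof -
  let ?N = "start n"
  let ?A = "{..?N} \<times> {..?N}"
  define r where "r = (\<lambda>(i, j) k. p i * h j * (orbit (period n + (i + j)) k - (if i + j \<le> ?N then orbit (i + j) k else 0)))"
  have orbit_comb: "orbit_comb ?N h = (\<lambda>k. \<Sum>j\<le>?N. h j * orbit j k)"
    unfolding orbit_comb_def[abs_def] using h by (simp add: lessThan_Suc_atMost[symmetric])
  have poly: "poly_at (period n) ?N p (orbit_comb ?N h) k = (\<Sum>(i, j)\<in>?A. p i * h j * orbit (period n + (i + j)) k)" for k
    unfolding poly_at_def orbit_comb
    by (subst iterate_sum) (simp_all add: orbit_in_koethe iterate_orbit sum.cartesian_product[symmetric] sum_distrib_left mult.assoc add_ac)
  have "orbit_conv ?N p h k = (\<Sum>j\<le>?N. \<Sum>i\<le>j. p i * h (j - i) * orbit (i + (j - i)) k)" for k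
    unfolding orbit_conv_def sum_distrib_right by (intro sum.cong) auto
  also have "\<dots> k = (\<Sum>(i, j)\<in>{(i, j). i + j \<le> ?N}. p i * h j * orbit (i + j) k)" for k
    by (rule sum.triangle_reindex_eq[symmetric])
  also have "\<dots> k = (\<Sum>q\<in>?A. if fst q + snd q \<le> ?N then p (fst q) * h (snd q) * orbit (fst q + snd q) k else 0)" for k
    unfolding sum.inter_filter[symmetric, OF finite_cartesian_product[OF finite_atMost finite_atMost]]
    by (intro sum.cong) auto
  finally have "(\<lambda>k. poly_at (period n) ?N p (orbit_comb ?N h) k - orbit_conv ?N p h k) = (\<lambda>k. \<Sum>q\<in>?A. r q k)"
    unfolding poly by (auto simp: r_def case_prod_beta fun_eq_iff algebra_simps sum_subtractf[symmetric] intro!: sum.cong)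
  moreover have r: "r q \<in> koethe \<beta> \<and> seminorm \<beta> M (r q) = 0" if "q \<in> ?A" for q
  proof -
    obtain i j where q: "q = (i, j)" by (cases q)
    define d where "d = (\<lambda>k. orbit (period n + (i + j)) k - (if i + j \<le> ?N then orbit (i + j) k else 0 :: 'a))"
    have ij: "i + j \<le> 2 * ?N" using that q by auto
    then have less: "i + j < period n" using period_ge[of n] by simp
    have "period n + (i + j) < start (Suc n)"
      using less start_Suc_ge[of n] by linarith
    then have eq: "orbit (period n + (i + j)) k = unit_vec (period n + (i + j)) k + orbit (i + j) k" for k
      using orbit_linked[of n "period n + (i + j)" k] by simp
    have "row (period n + (i + j)) = n"
      using row_block[of 1 n "i + j"] less by simp
    then have u: "seminorm \<beta> M (unit_vec (period n + (i + j)) :: nat \<Rightarrow> 'a) = 0"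
      using M by (simp add: seminorm_unit_vec weight_def)
    have d: "d \<in> koethe \<beta> \<and> seminorm \<beta> M d = 0"
    proof (cases "i + j \<le> ?N")
      case True
      then have "d = unit_vec (period n + (i + j))"
        by (simp add: d_def eq fun_eq_iff)
      then show ?thesis
        using u unit_vec_in_koethe by metis
    next
      case False
      then have "d = (\<lambda>k. unit_vec (period n + (i + j)) k + orbit (i + j) k)"
        by (simp add: d_def eq fun_eq_iff)
      moreover have "seminorm \<beta> M (orbit (i + j) :: nat \<Rightarrow> 'a) = 0"
        using False ij M orbit_weight_invisible_le[of M n "i + j" \<beta>] by (simp add: seminorm_orbit)
      ultimately show ?thesis
        using koethe_add(1)[of "unit_vec (period n + (i + j)) :: nat \<Rightarrow> 'a" \<beta> "orbit (i + j)"]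
          koethe_add(2)[of "unit_vec (period n + (i + j)) :: nat \<Rightarrow> 'a" \<beta> "orbit (i + j)" M] u
          seminorm_nonneg[of \<beta> M d] by (simp add: unit_vec_in_koethe orbit_in_koethe)
    qed
    have "r q = (\<lambda>k. (p i * h j) * d k)"
      by (simp add: r_def q d_def)
    then show ?thesis
      using d by (simp add: koethe_cmult)
  qed
  ultimately show ?thesis
    using koethe_sum[of ?A r \<beta> M] r seminorm_nonneg[of \<beta> M "\<lambda>k. \<Sum>q\<in>?A. r q k"]
    by (simp add: sum.neutral)
qed

end

locale cyclic_weights = fast_weights \<beta> for \<beta> +
  fixes ty :: "'a::{real_normed_field, banach} itself"
  assumes uniformly_solvable: "uniformly_solvable TYPE('a) \<beta> m (\<beta> (Suc m))"
begin

text \<open>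
  The first summand of the bound is the error of the approximate solution on the head, the second one
  is the contribution of the tail.
\<close>

lemma approximation_step:
  fixes x :: "nat \<Rightarrow> 'a"
  assumes x: "x \<in> koethe \<beta>" and M: "Suc M < m"
    and pos: "0 < seminorm \<beta> M (head (period m) x)"
    and dom: "seminorm \<beta> (Suc M) x \<le> real (Suc m) * (seminorm \<beta> M (head (period m) x) - seminorm \<beta> (Suc M) (tail (period m) x))"
  obtains p where "seminorm \<beta> M (\<lambda>k. poly_at (period (Suc m)) (start (Suc m)) p x k - unit_vec 0 k)
    \<le> 1 / real (Suc m) + seminorm \<beta> (M + 2) (tail (start (Suc m)) x) / seminorm \<beta> M (head (period m) x)"
proof -
  let ?n = "Suc m"
  let ?N = "start ?n"
  define y where "y = head ?N x"
  define t where "t = tail ?N x"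
  have CN: "period m \<le> ?N" using period_less_start[of m] by simp
  obtain h where h: "\<And>l. ?N \<le> l \<Longrightarrow> h l = 0" "y = orbit_comb ?N h"
    using orbit_comb_surj[of ?N y] by (auto simp: y_def head_def)
  have head_y: "head (period m) y = head (period m) x"
    using CN by (auto simp: y_def head_def fun_eq_iff)
  have tail_y: "tail (period m) y = head ?N (tail (period m) x)"
    by (auto simp: y_def head_def tail_def fun_eq_iff)
  have head_le: "seminorm \<beta> K (head N z) \<le> seminorm \<beta> K z" if "z \<in> koethe \<beta>" for K N and z :: "nat \<Rightarrow> 'a"
    using seminorm_head_tail[OF that, of K N] seminorm_nonneg[of \<beta> K "tail N z"] by simp
  have y_ge: "seminorm \<beta> M (head (period m) x) \<le> seminorm \<beta> M y"
    using head_le[of y M "period m"] head_y by (simp add: y_def head_in_koethe)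
  have "h \<noteq> (\<lambda>_. 0)"
  proof
    assume "h = (\<lambda>_. 0)"
    then have "y = (\<lambda>_. 0)"
      using h(2) by (simp add: orbit_comb_def fun_eq_iff)
    then have "seminorm \<beta> M y = 0"
      by (simp add: seminorm_def)
    then show False
      using y_ge pos by simp
  qed
  moreover have "dominant \<beta> m M y"
  proof -
    have "seminorm \<beta> (Suc M) y \<le> seminorm \<beta> (Suc M) x"
      unfolding y_def by (rule head_le[OF x])
    also note dom
    also have "real (Suc m) * (seminorm \<beta> M (head (period m) x) - seminorm \<beta> (Suc M) (tail (period m) x))
        \<le> real (Suc m) * (seminorm \<beta> M (head (period m) y) - seminorm \<beta> (Suc M) (tail (period m) y))"
      unfolding head_y tail_y using head_le[OF tail_in_koethe[OF x]] by (intro mult_left_mono diff_mono) auto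
    finally show ?thesis
      unfolding dominant_def .
  qed
  ultimately obtain p where p: "solvable \<beta> m h p M (\<beta> ?n)"
    using uniformly_solvable[of m] h M unfolding uniformly_solvable_def by (metis Suc_lessD)
  define P where "P = (\<Sum>i\<le>?N. norm (p i))"
  have P: "p 0 = 0" "P * seminorm \<beta> M y \<le> \<beta> ?n"
    "seminorm \<beta> M (\<lambda>k. orbit_conv ?N p h k - unit_vec 0 k) \<le> 1 / real ?n"
    using p h(2) by (auto simp: solvable_def P_def)
  have y: "y \<in> koethe \<beta>" and t: "t \<in> koethe \<beta>"
    unfolding y_def t_def by (auto intro: head_in_koethe tail_in_koethe x)
  let ?G = "poly_at (period ?n) ?N p"
  have xyt: "x = (\<lambda>k. y k + t k)"
    by (auto simp: y_def t_def head_def tail_def)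
  have yG: "?G y \<in> koethe \<beta>" and tG: "?G t \<in> koethe \<beta>"
    using y t by (auto intro: poly_at_in_koethe)
  have cX: "orbit_conv ?N p h \<in> koethe \<beta>"
    by (rule koethe_finite_support(1)[of "{..?N}"]) (auto simp: orbit_conv_above)
  have "?G x k = ?G y k + ?G t k" for k
    unfolding xyt using poly_at_add[OF y t] by metis
  then have split: "(\<lambda>k. ?G x k - unit_vec 0 k) =
      (\<lambda>k. ((?G y k - orbit_conv ?N p h k) + (orbit_conv ?N p h k - unit_vec 0 k)) + ?G t k)"
    by (simp add: fun_eq_iff)
  have "seminorm \<beta> M (\<lambda>k. ?G x k - unit_vec 0 k) \<le>
      seminorm \<beta> M (\<lambda>k. ?G y k - orbit_conv ?N p h k) + seminorm \<beta> M (\<lambda>k. orbit_conv ?N p h k - unit_vec 0 k) + seminorm \<beta> M (?G t)"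
    unfolding split
    using koethe_add(2)[OF koethe_add(1)[OF koethe_diff(1)[OF yG cX] orbit_conv_in_koethe] tG, of M ?N p h]
      koethe_add(2)[OF koethe_diff(1)[OF yG cX] orbit_conv_in_koethe, of M ?N p h] by linarith
  also have "seminorm \<beta> M (\<lambda>k. ?G y k - orbit_conv ?N p h k) = 0"
    unfolding h(2) using M by (intro poly_at_orbit_comb h) auto
  also have "seminorm \<beta> M (?G t) \<le> seminorm \<beta> (M + 2) t / seminorm \<beta> M (head (period m) x)"
  proof -
    have "\<beta> ?n * seminorm \<beta> M (?G t) \<le> P * seminorm \<beta> (M + 2) t"
      unfolding P_def using M P(1) t by (intro poly_at_tail) (auto simp: t_def tail_def)
    then have "(\<beta> ?n * seminorm \<beta> M (?G t)) * seminorm \<beta> M (head (period m) x)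
        \<le> (P * seminorm \<beta> (M + 2) t) * seminorm \<beta> M (head (period m) x)"
      using pos by (intro mult_right_mono) auto
    also have "\<dots> \<le> (P * seminorm \<beta> (M + 2) t) * seminorm \<beta> M y"
      using y_ge by (intro mult_left_mono mult_nonneg_nonneg seminorm_nonneg) (auto simp: P_def intro: sum_nonneg)
    also have "\<dots> = (P * seminorm \<beta> M y) * seminorm \<beta> (M + 2) t"
      by simp
    also have "\<dots> \<le> \<beta> ?n * seminorm \<beta> (M + 2) t"
      by (intro mult_right_mono P seminorm_nonneg)
    finally have "\<beta> ?n * (seminorm \<beta> M (?G t) * seminorm \<beta> M (head (period m) x)) \<le> \<beta> ?n * seminorm \<beta> (M + 2) t"
      by (simp add: mult.assoc)
    then have "seminorm \<beta> M (?G t) * seminorm \<beta> M (head (period m) x) \<le> seminorm \<beta> (M + 2) t"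
      using beta_pos[of ?n] by simp
    then show ?thesis
      using pos by (simp add: pos_le_divide_eq)
  qed
  finally have "seminorm \<beta> M (\<lambda>k. ?G x k - unit_vec 0 k)
      \<le> 1 / real ?n + seminorm \<beta> (M + 2) t / seminorm \<beta> M (head (period m) x)"
    using P(3) by simp
  then show thesis
    unfolding t_def by (rule that)
qed

lemma cyclic:
  fixes x :: "nat \<Rightarrow> 'a"
  assumes x: "x \<in> koethe \<beta>" "x \<noteq> (\<lambda>_. 0)" and \<epsilon>: "0 < \<epsilon>"
  obtains c N p where "seminorm \<beta> M (\<lambda>k. poly_at c N p x k - unit_vec 0 k) < \<epsilon>"
proof -
  obtain l where l: "x l \<noteq> 0" using x(2) by auto
  \<comment> \<open>Seminorm \<open>M\<close> may vanish at \<open>x\<close>; raising it to the row of \<open>l\<close> makes \<open>x\<close> visible.\<close>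
  define K where "K = max M (row l)"
  define a where "a = seminorm \<beta> K x"
  have "0 < norm (x l) * weight \<beta> K l"
    using l weight_ge_1[of l K \<beta>] by (intro mult_pos_pos) (auto simp: K_def)
  also have "\<dots> \<le> seminorm \<beta> K (head (Suc l) x)"
    unfolding seminorm_head by (rule member_le_sum) auto
  also have "\<dots> \<le> a"
    unfolding a_def using seminorm_head_tail[OF x(1), of K "Suc l"] seminorm_nonneg[of \<beta> K "tail (Suc l) x"] by simp
  finally have a: "0 < a" .
  have period: "filterlim period at_top at_top"
  proof (rule filterlim_at_top_mono[OF filterlim_ident])
    show "\<forall>\<^sub>F n in sequentially. n \<le> period n"
      using start_ge start_less_period by (intro always_eventually) (meson le_trans less_imp_le)
  qed
  have start: "filterlim (\<lambda>m. start (Suc m)) at_top at_top"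
  proof (rule filterlim_at_top_mono[OF filterlim_ident])
    show "\<forall>\<^sub>F m in sequentially. m \<le> start (Suc m)"
      using start_ge by (intro always_eventually) (meson Suc_leD)
  qed
  have tail_period: "(\<lambda>m. seminorm \<beta> N (tail (period m) x)) \<longlonglongrightarrow> 0" for N
    using filterlim_compose[OF seminorm_tail_tendsto[OF x(1)] period] .
  have head_period: "(\<lambda>m. seminorm \<beta> N (head (period m) x)) \<longlonglongrightarrow> seminorm \<beta> N x" for N
    using filterlim_compose[OF seminorm_head_tendsto[OF x(1)] period] .
  have tail_start: "(\<lambda>m. seminorm \<beta> N (tail (start (Suc m)) x)) \<longlonglongrightarrow> 0" for N
    using filterlim_compose[OF seminorm_tail_tendsto[OF x(1)] start] .
  have "\<forall>\<^sub>F m in sequentially. a / 2 < seminorm \<beta> K (head (period m) x)"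
    using a by (intro order_tendstoD(1)[OF head_period]) (simp add: a_def)
  moreover have "\<forall>\<^sub>F m in sequentially. seminorm \<beta> (Suc K) (tail (period m) x) < a / 4"
    using a by (intro order_tendstoD(2)[OF tail_period]) simp
  moreover have "\<forall>\<^sub>F m in sequentially. seminorm \<beta> (K + 2) (tail (start (Suc m)) x) < \<epsilon> * a / 4"
    using a \<epsilon> by (intro order_tendstoD(2)[OF tail_start]) simp
  moreover have "\<forall>\<^sub>F m in sequentially. Suc K < m"
    by (rule eventually_gt_at_top)
  moreover have "\<forall>\<^sub>F m in sequentially. 2 / \<epsilon> < real m"
    using filterlim_real_sequentially unfolding filterlim_at_top_dense by blast
  moreover have "\<forall>\<^sub>F m in sequentially. seminorm \<beta> (Suc K) x / (a / 4) < real m"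
    using filterlim_real_sequentially unfolding filterlim_at_top_dense by blast
  ultimately have "\<forall>\<^sub>F m in sequentially. a / 2 < seminorm \<beta> K (head (period m) x) \<and>
      seminorm \<beta> (Suc K) (tail (period m) x) < a / 4 \<and> seminorm \<beta> (K + 2) (tail (start (Suc m)) x) < \<epsilon> * a / 4 \<and>
      Suc K < m \<and> 2 / \<epsilon> < real m \<and> seminorm \<beta> (Suc K) x / (a / 4) < real m"
    by eventually_elim blast
  then obtain m where m: "a / 2 < seminorm \<beta> K (head (period m) x)" "seminorm \<beta> (Suc K) (tail (period m) x) < a / 4"
    "seminorm \<beta> (K + 2) (tail (start (Suc m)) x) < \<epsilon> * a / 4" "Suc K < m" "2 / \<epsilon> < real m"
    "seminorm \<beta> (Suc K) x / (a / 4) < real m"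
    using eventually_happens'[OF sequentially_bot] by blast
  have pos: "0 < seminorm \<beta> K (head (period m) x)" using m(1) a by linarith
  have "seminorm \<beta> (Suc K) x \<le> real (Suc m) * (a / 4)"
    using m(6) a by (simp add: divide_less_eq field_simps)
  also have "\<dots> \<le> real (Suc m) * (seminorm \<beta> K (head (period m) x) - seminorm \<beta> (Suc K) (tail (period m) x))"
    using m by (intro mult_left_mono) auto
  finally obtain p where p: "seminorm \<beta> K (\<lambda>k. poly_at (period (Suc m)) (start (Suc m)) p x k - unit_vec 0 k)
    \<le> 1 / real (Suc m) + seminorm \<beta> (K + 2) (tail (start (Suc m)) x) / seminorm \<beta> K (head (period m) x)"
    using approximation_step[OF x(1) m(4) pos] by blast
  have "1 / real (Suc m) < \<epsilon> / 2"
    using m(5) \<epsilon> by (simp add: field_simps)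
  moreover have "seminorm \<beta> (K + 2) (tail (start (Suc m)) x) / seminorm \<beta> K (head (period m) x) < \<epsilon> / 2"
  proof -
    have "seminorm \<beta> (K + 2) (tail (start (Suc m)) x) < \<epsilon> / 2 * (a / 2)"
      using m(3) by simp
    also have "\<dots> < \<epsilon> / 2 * seminorm \<beta> K (head (period m) x)"
      using m(1) \<epsilon> by (intro mult_strict_left_mono) auto
    finally show ?thesis
      using pos by (simp add: divide_less_eq)
  qed
  ultimately have "seminorm \<beta> K (\<lambda>k. poly_at (period (Suc m)) (start (Suc m)) p x k - unit_vec 0 k) < \<epsilon>"
    using p by linarith
  moreover have "(\<lambda>k. poly_at (period (Suc m)) (start (Suc m)) p x k - unit_vec 0 k) \<in> koethe \<beta>"
    by (intro koethe_diff poly_at_in_koethe x unit_vec_in_koethe)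
  then have "seminorm \<beta> M (\<lambda>k. poly_at (period (Suc m)) (start (Suc m)) p x k - unit_vec 0 k)
      \<le> seminorm \<beta> K (\<lambda>k. poly_at (period (Suc m)) (start (Suc m)) p x k - unit_vec 0 k)"
    by (rule seminorm_mono) (simp add: K_def)
  ultimately show thesis
    using that by (meson le_less_trans)
qed

theorem no_invariant_subspace:
  fixes H :: "(nat \<Rightarrow> 'a) set"
  assumes sub: "H \<subseteq> koethe \<beta>"
    and add: "\<And>x y. x \<in> H \<Longrightarrow> y \<in> H \<Longrightarrow> (\<lambda>k. x k + y k) \<in> H"
    and cmult: "\<And>a x. x \<in> H \<Longrightarrow> (\<lambda>k. a * x k) \<in> H"
    and closed: "\<And>x. x \<in> koethe \<beta> \<Longrightarrow> (\<And>N \<epsilon>. 0 < \<epsilon> \<Longrightarrow> \<exists>y\<in>H. seminorm \<beta> N (\<lambda>k. y k - x k) < \<epsilon>) \<Longrightarrow> x \<in> H"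
    and inv: "\<And>x. x \<in> H \<Longrightarrow> shift_op x \<in> H"
    and nz: "x \<in> H" "x \<noteq> (\<lambda>_. 0)"
  shows "H = koethe \<beta>"
proof -
  have sum: "(\<lambda>k. \<Sum>i\<in>A. a i * y i k) \<in> H" if "finite A" "\<And>i. i \<in> A \<Longrightarrow> y i \<in> H"
    for A :: "nat set" and a :: "nat \<Rightarrow> 'a" and y
    using that
  proof (induction A)
    case empty
    show ?case using cmult[OF nz(1), of 0] by simp
  next
    case (insert i A)
    then show ?case using add cmult by simp
  qed
  have iter: "(shift_op ^^ h) y \<in> H" if "y \<in> H" for h y
    using that by (induction h) (auto intro: inv)
  have "unit_vec 0 \<in> H"
  proof (rule closed[OF unit_vec_in_koethe])
    fix N and \<epsilon> :: real assume "0 < \<epsilon>"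
    then obtain c K p where "seminorm \<beta> N (\<lambda>k. poly_at c K p x k - unit_vec 0 k) < \<epsilon>"
      using cyclic[of x \<epsilon> N] sub nz by blast
    moreover have "poly_at c K p x \<in> H"
      unfolding poly_at_def[abs_def] by (intro sum iter nz) auto
    ultimately show "\<exists>y\<in>H. seminorm \<beta> N (\<lambda>k. y k - unit_vec 0 k) < \<epsilon>" by blast
  qed
  moreover have "(orbit 0 :: nat \<Rightarrow> 'a) = unit_vec 0"
    using orbit_support_le[of _ 0] by (auto simp: orbit_def unit_vec_def fun_eq_iff)
  ultimately have "orbit 0 \<in> H"
    by simp
  then have orbit: "orbit k \<in> H" for k
    using iter[of "orbit 0" k] unfolding iterate_orbit by simp
  have unit_vec: "unit_vec l \<in> H" for l
  proof (cases "linked l")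
    case True
    then have "(unit_vec l :: nat \<Rightarrow> 'a) = (\<lambda>k. orbit l k + (-1) * orbit (l - period (stage l)) k)"
      using orbit_unit_vec[of l, where 'a='a] by (simp add: fun_eq_iff)
    then show ?thesis
      using add[OF orbit cmult[OF orbit]] by metis
  next
    case False
    then have "(unit_vec l :: nat \<Rightarrow> 'a) = orbit l"
      using orbit_unit_vec[of l, where 'a='a] by (simp add: fun_eq_iff)
    then show ?thesis using orbit by metis
  qed
  have "y \<in> H" if y: "y \<in> koethe \<beta>" for y
  proof (rule closed[OF y])
    fix N and \<epsilon> :: real assume "0 < \<epsilon>"
    then have "\<forall>\<^sub>F m in sequentially. seminorm \<beta> N (tail m y) < \<epsilon>"
      by (intro order_tendstoD(2)[OF seminorm_tail_tendsto[OF y]])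
    then obtain m where "seminorm \<beta> N (tail m y) < \<epsilon>"
      using eventually_happens'[OF sequentially_bot] by blast
    moreover have "seminorm \<beta> N (\<lambda>k. head m y k - y k) = seminorm \<beta> N (tail m y)"
      unfolding seminorm_def by (intro infsum_cong) (simp add: head_def tail_def)
    moreover have "head m y \<in> H"
      unfolding head_expand by (intro sum unit_vec) auto
    ultimately show "\<exists>z\<in>H. seminorm \<beta> N (\<lambda>k. z k - y k) < \<epsilon>"
      by (intro bexI[of _ "head m y"]) auto
  qed
  then show ?thesis using sub by blast
qed

end

section \<open>Columns: the rows are copies of s\<close>

definition columns :: "(nat \<Rightarrow> nat) \<Rightarrow> nat \<Rightarrow> nat set" where
  "columns \<beta> k = (\<lambda>l. base \<beta> l - 1) ` {l. row l = k}"

definition col :: "(nat \<Rightarrow> nat) \<Rightarrow> nat \<Rightarrow> nat" where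
  "col \<beta> l = (THE j. enumerate (columns \<beta> (row l)) j = base \<beta> l - 1)"

definition pos :: "(nat \<Rightarrow> nat) \<Rightarrow> nat \<Rightarrow> nat \<times> nat" where
  "pos \<beta> l = (row l, col \<beta> l)"

lemma even_in_columns: "2 * j \<in> columns \<beta> k"
proof -
  define n where "n = prod_encode (k, j)"
  have "row (start n) = k" "base \<beta> (start n) - 1 = 2 * j"
    by (simp_all add: row_start base_def n_def)
  then show ?thesis
    unfolding columns_def by (metis (mono_tags, lifting) image_eqI mem_Collect_eq)
qed

lemma infinite_columns: "infinite (columns \<beta> k)"
proof
  assume "finite (columns \<beta> k)"
  moreover have "range (\<lambda>j. 2 * j) \<subseteq> columns \<beta> k"
    using even_in_columns by blast
  ultimately have "finite (range (\<lambda>j::nat. 2 * j))"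
    by (rule rev_finite_subset)
  then show False
    by (simp add: finite_image_iff inj_on_def)
qed

text \<open>
  Because the even numbers are present, enumerating the columns of a row changes them at most by a
  factor \<open>2\<close>, and the weighted row is isomorphic to \<open>s\<close>.
\<close>

lemma enumerate_columns_le: "enumerate (columns \<beta> k) j \<le> 2 * j"
proof (induction j)
  case 0
  have "(0::nat) \<in> columns \<beta> k"
    using even_in_columns[of 0] by simp
  then show ?case
    unfolding enumerate_0 by (metis Least_eq_0 le0 le_numeral_extra(3) mult_0_right)
next
  case (Suc j)
  show ?case
    unfolding enumerate_Suc''[OF infinite_columns]
    using Suc even_in_columns[of "Suc j"] by (intro Least_le) auto
qed

lemma enumerate_col: "enumerate (columns \<beta> (row l)) (col \<beta> l) = base \<beta> l - 1"
proof -
  have "base \<beta> l - 1 \<in> columns \<beta> (row l)"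
    by (auto simp: columns_def)
  then have "\<exists>!j. enumerate (columns \<beta> (row l)) j = base \<beta> l - 1"
    using bij_enumerate[OF infinite_columns, of \<beta> "row l"] unfolding bij_betw_def inj_on_def by (metis UNIV_I imageE)
  then show ?thesis
    unfolding col_def by (rule theI')
qed

lemma base_col:
  "col \<beta> l + 1 \<le> base \<beta> l" "base \<beta> l \<le> 2 * (col \<beta> l + 1)"
  using le_enumerate[OF infinite_columns[of \<beta> "row l"], of "col \<beta> l"]
    enumerate_columns_le[of \<beta> "row l" "col \<beta> l"] base_pos[of \<beta> l]
  unfolding enumerate_col by arith+

context fast_weights
begin

text \<open>
  Parity separates the first indices of the stages from the others. The former are told apart by the pair
  they encode, the latter because \<open>(\<beta> n)\<^sup>2 + l\<close> is strictly increasing in \<open>l\<close>.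
\<close>

lemma base_inj:
  assumes "row l = row l'" "base \<beta> l = base \<beta> l'"
  shows "l = l'"
proof -
  have fresh_less: "l < l' \<Longrightarrow> (\<beta> (stage l))\<^sup>2 + l < (\<beta> (stage l'))\<^sup>2 + l'" for l l'
  proof -
    assume "l < l'"
    then have "start (stage l) < start (Suc (stage l'))"
      using stage_lower[of l] stage_upper[of l'] by linarith
    then have "stage l \<le> stage l'"
      using strict_mono_less[OF strict_mono_start] by simp
    then have "(\<beta> (stage l))\<^sup>2 \<le> (\<beta> (stage l'))\<^sup>2"
      using beta_mono by (intro power_mono) auto
    then show "(\<beta> (stage l))\<^sup>2 + l < (\<beta> (stage l'))\<^sup>2 + l'"
      using \<open>l < l'\<close> by (rule add_le_less_mono)
  qed
  have fill: "base \<beta> l = 2 * snd (prod_decode (stage l)) + 1" if "l = start (stage l)" for l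
    using that by (simp add: base_def Let_def)
  have fresh: "base \<beta> l = 2 * ((\<beta> (stage l))\<^sup>2 + l) + 2" if "l \<noteq> start (stage l)" for l
    using that by (simp add: base_def Let_def)
  show ?thesis
  proof (cases "l = start (stage l) \<longleftrightarrow> l' = start (stage l')")
    case False
    then have "odd (base \<beta> l) \<noteq> odd (base \<beta> l')"
      using fill[of l] fill[of l'] fresh[of l] fresh[of l'] by auto
    then show ?thesis using assms by simp
  next
    case True
    show ?thesis
    proof (cases "l = start (stage l)")
      case fillpos: True
      then have "snd (prod_decode (stage l)) = snd (prod_decode (stage l'))"
        using True fill[of l] fill[of l'] assms(2) by simp
      moreover have "fst (prod_decode (stage l)) = fst (prod_decode (stage l'))"
        using True fillpos assms(1) row_start[of "stage l"] row_start[of "stage l'"] by simp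
      ultimately have "stage l = stage l'"
        by (metis prod_decode_inverse prod_eqI)
      then show ?thesis using True fillpos by metis
    next
      case False
      then have "(\<beta> (stage l))\<^sup>2 + l = (\<beta> (stage l'))\<^sup>2 + l'"
        using True fresh[of l] fresh[of l'] assms(2) by simp
      then show ?thesis
        using fresh_less[of l l'] fresh_less[of l' l] by (cases l l' rule: linorder_cases) auto
    qed
  qed
qed

lemma bij_pos: "bij (pos \<beta>)"
proof (rule bijI)
  show "inj (pos \<beta>)"
  proof (rule injI)
    fix l l' assume eq: "pos \<beta> l = pos \<beta> l'"
    then have row: "row l = row l'" and col: "col \<beta> l = col \<beta> l'"
      by (simp_all add: pos_def)
    have "base \<beta> l - 1 = base \<beta> l' - 1"
      using enumerate_col[of \<beta> l] enumerate_col[of \<beta> l'] unfolding row col by (rule trans[OF sym])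
    then have "base \<beta> l = base \<beta> l'"
      using base_pos[of \<beta> l] base_pos[of \<beta> l'] by arith
    with row show "l = l'"
      by (rule base_inj)
  qed
  have "\<exists>l. pos \<beta> l = (k, j)" for k j
  proof -
    have "enumerate (columns \<beta> k) j \<in> columns \<beta> k"
      by (rule enumerate_in_set[OF infinite_columns])
    then obtain l where l: "row l = k" "enumerate (columns \<beta> k) j = base \<beta> l - 1"
      by (auto simp: columns_def)
    have "enumerate (columns \<beta> k) (col \<beta> l) = base \<beta> l - 1"
      using enumerate_col[of \<beta> l] unfolding l(1) .
    then have "enumerate (columns \<beta> k) (col \<beta> l) = enumerate (columns \<beta> k) j"
      unfolding l(2) .
    then have "col \<beta> l = j"
      using inj_enumerate[OF infinite_columns] by (simp add: inj_eq)
    then show ?thesis using l by (auto simp: pos_def)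
  qed
  then show "surj (pos \<beta>)"
    by (metis surjI surj_def surj_pair)
qed

end

section \<open>Neighbourhoods in s\<close>

lemma seq_nth_plus: "seq_nth (x + y) j = seq_nth x j + seq_nth y j"
  by (simp add: plus_rapid_seq.rep_eq)

lemma seq_nth_minus: "seq_nth (x - y) j = seq_nth x j - seq_nth y j"
  unfolding minus_rapid_seq_def plus_rapid_seq.rep_eq uminus_rapid_seq.rep_eq by simp

lemma rapid_has_sum:
  "((\<lambda>j. norm (seq_nth x j) * real (j + 1) ^ N) has_sum rapid_seminorm N x) UNIV"
proof -
  have "summable (\<lambda>j. norm (seq_nth x j) * real (j + 1) ^ N)"
    using seq_nth[of x] by simp
  then show ?thesis
    unfolding rapid_seminorm_def by (intro sums_nonneg_imp_has_sum summable_sums) auto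
qed

lemma rapid_seminorm_eq:
  "rapid_seminorm N x = (\<Sum>\<^sub>\<infinity>j. norm (seq_nth x j) * real (j + 1) ^ N)"
  using infsumI[OF rapid_has_sum[of x N]] by simp

lemma rapid_summable_on: "(\<lambda>j. norm (seq_nth x j) * real (j + 1) ^ N) summable_on UNIV"
  using rapid_has_sum by (rule has_sum_imp_summable)

lemma rapid_seminorm_mono: "N \<le> M \<Longrightarrow> rapid_seminorm N x \<le> rapid_seminorm M x"
  unfolding rapid_seminorm_eq
  by (intro infsum_mono rapid_summable_on mult_left_mono power_increasing) auto

lemma rapid_seminorm_zero: "rapid_seminorm N 0 = 0"
  by (simp add: rapid_seminorm_def zero_rapid_seq.rep_eq)

lemma rapid_seminorm_triangle:
  "rapid_seminorm N (x - z) \<le> rapid_seminorm N (x - y) + rapid_seminorm N (y - z)"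
proof -
  have le: "norm (seq_nth (x - z) j) * real (j + 1) ^ N \<le>
      norm (seq_nth (x - y) j) * real (j + 1) ^ N + norm (seq_nth (y - z) j) * real (j + 1) ^ N" for j
  proof -
    have "norm (seq_nth (x - z) j) \<le> norm (seq_nth (x - y) j) + norm (seq_nth (y - z) j)"
      using norm_triangle_ineq[of "seq_nth (x - y) j" "seq_nth (y - z) j"] by (simp add: seq_nth_minus)
    then show ?thesis
      unfolding distrib_right[symmetric] by (rule mult_right_mono) simp
  qed
  have "rapid_seminorm N (x - z) \<le> (\<Sum>\<^sub>\<infinity>j. norm (seq_nth (x - y) j) * real (j + 1) ^ N
      + norm (seq_nth (y - z) j) * real (j + 1) ^ N)"
    unfolding rapid_seminorm_eq by (intro infsum_mono summable_on_add rapid_summable_on le)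
  also have "\<dots> = rapid_seminorm N (x - y) + rapid_seminorm N (y - z)"
    unfolding rapid_seminorm_eq by (intro infsum_add rapid_summable_on)
  finally show ?thesis .
qed

lemma open_rapid_ball: "0 < e \<Longrightarrow> open {y. rapid_seminorm N (y - x) < e}"
  unfolding open_rapid_seq_def by (rule generate_topology.Basis) blast

lemma open_rapid_contains_ball:
  assumes "open U" "x \<in> U"
  obtains N e where "0 < e" "{y. rapid_seminorm N (y - x) < e} \<subseteq> U"
proof -
  have "generate_topology {{y. rapid_seminorm N (y - x) < e} | x N e. 0 < e} U"
    using assms(1) by (simp add: open_rapid_seq_def)
  then have "x \<in> U \<Longrightarrow> \<exists>N e. 0 < e \<and> {y. rapid_seminorm N (y - x) < e} \<subseteq> U"
  proof induction
    case UNIV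
    show ?case by (intro exI[of _ 0] exI[of _ 1]) auto
  next
    case (Int A B)
    then obtain N e M d where *: "0 < e" "{y. rapid_seminorm N (y - x) < e} \<subseteq> A"
      "0 < d" "{y. rapid_seminorm M (y - x) < d} \<subseteq> B"
      by auto
    have "{y. rapid_seminorm (max N M) (y - x) < min e d} \<subseteq> A \<inter> B"
    proof
      fix y assume "y \<in> {y. rapid_seminorm (max N M) (y - x) < min e d}"
      then show "y \<in> A \<inter> B"
        using * rapid_seminorm_mono[of N "max N M" "y - x"] rapid_seminorm_mono[of M "max N M" "y - x"]
        by auto
    qed
    then show ?case
      using * by (intro exI[of _ "max N M"] exI[of _ "min e d"]) auto
  next
    case (UN \<K>)
    then show ?case by (meson Sup_upper UnionE order_trans)
  next
    case (Basis B)
    then obtain z N e where B: "B = {y. rapid_seminorm N (y - z) < e}" by blast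
    have "{y. rapid_seminorm N (y - x) < e - rapid_seminorm N (x - z)} \<subseteq> B"
    proof
      fix y assume "y \<in> {y. rapid_seminorm N (y - x) < e - rapid_seminorm N (x - z)}"
      then show "y \<in> B"
        using rapid_seminorm_triangle[of N y z x] by (simp add: B)
    qed
    then show ?case
      using Basis by (intro exI[of _ N] exI[of _ "e - rapid_seminorm N (x - z)"]) (auto simp: B)
  qed
  then show thesis
    using assms(2) that by blast
qed

section \<open>Transfer to the product space\<close>

definition coords :: "(nat \<Rightarrow> nat) \<Rightarrow> (nat \<Rightarrow> 'a::real_normed_field rapid_seq) \<Rightarrow> nat \<Rightarrow> 'a" where
  "coords \<beta> u l = seq_nth (u (row l)) (col \<beta> l)"

definition of_coords :: "(nat \<Rightarrow> nat) \<Rightarrow> (nat \<Rightarrow> 'a::real_normed_field) \<Rightarrow> nat \<Rightarrow> 'a rapid_seq" where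
  "of_coords \<beta> x k = Abs_rapid_seq (\<lambda>j. x (inv (pos \<beta>) (k, j)))"

definition operator :: "(nat \<Rightarrow> nat) \<Rightarrow> (nat \<Rightarrow> 'a::real_normed_field rapid_seq) \<Rightarrow> nat \<Rightarrow> 'a rapid_seq" where
  "operator \<beta> u = of_coords \<beta> (shift_op (coords \<beta> u))"

lemma coords_plus: "coords \<beta> (u + v) = (\<lambda>l. coords \<beta> u l + coords \<beta> v l)"
  by (simp add: coords_def fun_eq_iff seq_nth_plus)

lemma coords_minus: "coords \<beta> (u - v) = (\<lambda>l. coords \<beta> u l - coords \<beta> v l)"
  by (rule ext) (simp only: coords_def minus_apply seq_nth_minus)

lemma coords_scale:
  "coords \<beta> (scale_rapid_seq_prod a u) = (\<lambda>l. a * coords \<beta> u l)"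
  by (rule ext) (simp only: coords_def scale_rapid_seq_prod_def scale_rapid_seq.rep_eq)

context fast_weights
begin

lemma inv_pos: "row (inv (pos \<beta>) (k, j)) = k" "col \<beta> (inv (pos \<beta>) (k, j)) = j"
  using surj_f_inv_f[OF bij_is_surj[OF bij_pos], of "(k, j)"] by (simp_all add: pos_def)

lemma coords_bound:
  fixes u :: "nat \<Rightarrow> 'a::real_normed_field rapid_seq"
  shows "coords \<beta> u \<in> koethe \<beta>" "seminorm \<beta> N (coords \<beta> u) \<le> 2 ^ N * (\<Sum>k\<le>N. rapid_seminorm N (u k))"
proof -
  define g where "g = (\<lambda>N (k, j). norm (seq_nth (u k) j) * real (j + 1) ^ N)"
  have g: "(g N has_sum (\<Sum>k\<le>N. rapid_seminorm N (u k))) ({..N} \<times> UNIV)" for N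
  proof (rule has_sum_SigmaI)
    show "((\<lambda>j. g N (k, j)) has_sum rapid_seminorm N (u k)) UNIV" for k
      unfolding g_def using rapid_has_sum by simp
    then show "g N summable_on {..N} \<times> UNIV"
      by (intro summable_on_SigmaI[where g = "\<lambda>k. rapid_seminorm N (u k)"]) (auto simp: g_def)
  qed (simp add: has_sum_finite)
  have "((\<lambda>q. if fst q \<le> N then g N q else 0) has_sum (\<Sum>k\<le>N. rapid_seminorm N (u k))) UNIV" for N
    by (rule has_sum_cong_neutral[THEN iffD1, rotated -1, OF g]) auto
  then have "((\<lambda>l. if row l \<le> N then g N (pos \<beta> l) else 0) has_sum (\<Sum>k\<le>N. rapid_seminorm N (u k))) UNIV" for N
    using has_sum_reindex_bij_betw[OF bij_pos, of "\<lambda>q. if fst q \<le> N then g N q else 0"]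
    by (simp add: pos_def)
  then have major: "((\<lambda>l. 2 ^ N * (if row l \<le> N then g N (pos \<beta> l) else 0)) has_sum
      2 ^ N * (\<Sum>k\<le>N. rapid_seminorm N (u k))) UNIV" for N
    by (rule has_sum_cmult_right)
  have le: "norm (coords \<beta> u l) * weight \<beta> N l \<le> 2 ^ N * (if row l \<le> N then g N (pos \<beta> l) else 0)" for N l
  proof (cases "row l \<le> N")
    case True
    have "real (base \<beta> l) ^ N \<le> (2 * real (col \<beta> l + 1)) ^ N"
      using base_col(2)[of \<beta> l] by (intro power_mono) linarith+
    then have "norm (coords \<beta> u l) * real (base \<beta> l) ^ N \<le> norm (coords \<beta> u l) * (2 * real (col \<beta> l + 1)) ^ N"
      by (intro mult_left_mono) auto
    then show ?thesis
      using True unfolding power_mult_distrib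
      by (simp add: weight_def g_def pos_def coords_def mult.left_commute)
  qed (simp add: weight_def)
  have sum: "(\<lambda>l. norm (coords \<beta> u l) * weight \<beta> N l) summable_on UNIV" for N
    by (rule summable_on_comparison_test[OF has_sum_imp_summable[OF major[of N]]]) (use le in auto)
  then show "coords \<beta> u \<in> koethe \<beta>"
    by (simp add: koethe_def)
  show "seminorm \<beta> N (coords \<beta> u) \<le> 2 ^ N * (\<Sum>k\<le>N. rapid_seminorm N (u k))"
    unfolding seminorm_def using has_sum_mono[OF has_sum_infsum[OF sum] major le] by simp
qed

lemma of_coords_bound:
  fixes x :: "nat \<Rightarrow> 'a::real_normed_field"
  assumes x: "x \<in> koethe \<beta>"
  shows "seq_nth (of_coords \<beta> x k) j = x (inv (pos \<beta>) (k, j))"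
    and "rapid_seminorm N (of_coords \<beta> x k) \<le> seminorm \<beta> (max N k) x"
proof -
  let ?i = "\<lambda>j. inv (pos \<beta>) (k, j)"
  have inj: "inj ?i"
    by (rule injI) (metis inv_pos(2))
  define f where "f = (\<lambda>N l. norm (x l) * weight \<beta> N l)"
  have f: "f N summable_on A" for N A
    unfolding f_def using koethe_D[OF x] by simp
  have fi: "(\<lambda>j. f N (?i j)) summable_on UNIV" for N
    using f[of N "range ?i"] unfolding summable_on_reindex[OF inj] by (simp add: o_def)
  have le: "norm (x (?i j)) * real (j + 1) ^ N \<le> f (max N k) (?i j)" for N j
  proof -
    have "real (j + 1) \<le> real (base \<beta> (?i j))"
      using base_col(1)[of \<beta> "?i j"] by (simp add: inv_pos)
    then have "real (j + 1) ^ N \<le> real (base \<beta> (?i j)) ^ N"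
      by (intro power_mono) auto
    also have "\<dots> \<le> real (base \<beta> (?i j)) ^ max N k"
      using base_pos[of \<beta> "?i j"] by (intro power_increasing) auto
    finally show ?thesis
      by (simp add: f_def weight_def inv_pos mult_left_mono)
  qed
  have sum: "(\<lambda>j. norm (x (?i j)) * real (j + 1) ^ N) summable_on UNIV" for N
    by (rule summable_on_comparison_test[OF fi[of "max N k"]]) (use le in auto)
  have "summable (\<lambda>j. norm (x (?i j)) * real (j + 1) ^ N)" for N
    using has_sum_imp_sums[OF has_sum_infsum[OF sum]] by (simp add: sums_iff)
  then show nth: "seq_nth (of_coords \<beta> x k) j = x (?i j)" for j
    unfolding of_coords_def by (subst Abs_rapid_seq_inverse) simp_all
  have "rapid_seminorm N (of_coords \<beta> x k) \<le> (\<Sum>\<^sub>\<infinity>j. f (max N k) (?i j))"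
    unfolding rapid_seminorm_eq nth by (intro infsum_mono sum fi le)
  also have "\<dots> = infsum (f (max N k)) (range ?i)"
    unfolding infsum_reindex[OF inj] by (simp add: o_def)
  also have "\<dots> \<le> infsum (f (max N k)) UNIV"
    by (intro infsum_mono2 f) (auto simp: f_def)
  finally show "rapid_seminorm N (of_coords \<beta> x k) \<le> seminorm \<beta> (max N k) x"
    by (simp add: f_def seminorm_def)
qed

lemma coords_of_coords:
  "x \<in> koethe \<beta> \<Longrightarrow> coords \<beta> (of_coords \<beta> x) = x"
  using inv_f_f[OF bij_is_inj[OF bij_pos]] by (simp add: coords_def of_coords_bound pos_def fun_eq_iff)

lemma rapid_seq_prod_eqI: "(\<And>k j. seq_nth (u k) j = seq_nth (v k) j) \<Longrightarrow> u = v"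
  by (metis ext seq_nth_inject)

lemma of_coords_coords: "of_coords \<beta> (coords \<beta> u) = u"
  by (rule rapid_seq_prod_eqI) (simp add: of_coords_bound coords_bound coords_def inv_pos)

lemma coords_operator:
  fixes u :: "nat \<Rightarrow> 'a::{real_normed_field, banach} rapid_seq"
  shows "coords \<beta> (operator \<beta> u) = shift_op (coords \<beta> u)"
  unfolding operator_def by (intro coords_of_coords shift_op_in_koethe coords_bound)

lemma coords_inject: "coords \<beta> u = coords \<beta> v \<Longrightarrow> u = v"
  using of_coords_coords by metis

lemma operator_linear:
  "Vector_Spaces.linear scale_rapid_seq_prod scale_rapid_seq_prod
     (operator \<beta> :: (nat \<Rightarrow> 'a::{real_normed_field, banach} rapid_seq) \<Rightarrow> _)"
  unfolding Vector_Spaces.linear_iff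
proof (intro conjI allI)
  show "vector_space (scale_rapid_seq_prod :: 'a \<Rightarrow> _)"
    by (rule rapid_seq_prod.vector_space_axioms)
  then show "vector_space (scale_rapid_seq_prod :: 'a \<Rightarrow> _)" .
  fix u v :: "nat \<Rightarrow> 'a rapid_seq" and a :: 'a
  show "operator \<beta> (u + v) = operator \<beta> u + operator \<beta> v"
    by (rule coords_inject) (simp add: coords_operator coords_plus shift_op_add coords_bound)
  show "operator \<beta> (scale_rapid_seq_prod a u) = scale_rapid_seq_prod a (operator \<beta> u)"
    by (rule coords_inject) (simp add: coords_operator coords_scale shift_op_cmult)
qed

lemma seminorm_le_coords:
  "rapid_seminorm N (u k) \<le> seminorm \<beta> (max N k) (coords \<beta> u)"
  using of_coords_bound(2)[OF coords_bound(1), of N u k] by (simp add: of_coords_coords)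

lemma operator_diff:
  fixes u v :: "nat \<Rightarrow> 'a::{real_normed_field, banach} rapid_seq"
  shows "operator \<beta> (u - v) = operator \<beta> u - operator \<beta> v"
proof -
  interpret Vector_Spaces.linear scale_rapid_seq_prod scale_rapid_seq_prod "operator \<beta> :: (nat \<Rightarrow> 'a rapid_seq) \<Rightarrow> _"
    by (rule operator_linear)
  show ?thesis by (rule diff)
qed

lemma operator_continuous:
  "continuous_on UNIV (operator \<beta> :: (nat \<Rightarrow> 'a::{real_normed_field, banach} rapid_seq) \<Rightarrow> _)"
proof (rule continuous_on_coordinatewise_then_product)
  fix k
  show "continuous_on UNIV (\<lambda>u :: nat \<Rightarrow> 'a rapid_seq. operator \<beta> u k)"
    unfolding continuous_on_open_vimage[OF open_UNIV] Int_UNIV_right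
  proof (intro allI impI)
    fix B :: "'a rapid_seq set" assume B: "open B"
    show "open ((\<lambda>u. operator \<beta> u k) -` B)"
      unfolding open_subopen[of "(\<lambda>u. operator \<beta> u k) -` B"]
    proof
      fix u assume "u \<in> (\<lambda>u. operator \<beta> u k) -` B"
      then have "operator \<beta> u k \<in> B"
        by simp
      then obtain N e where e: "0 < e" "{y. rapid_seminorm N (y - operator \<beta> u k) < e} \<subseteq> B"
        using open_rapid_contains_ball[OF B] by blast
      define M where "M = max N k + 2"
      obtain c :: real where c: "0 \<le> c"
        "\<And>x :: nat \<Rightarrow> 'a. x \<in> koethe \<beta> \<Longrightarrow> seminorm \<beta> (max N k) (shift_op x) \<le> c * seminorm \<beta> M x"
        using shift_op_bound[of "max N k", where 'a='a] unfolding M_def by blast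
      define d where "d = e / (c * 2 ^ M * (M + 1) + 1)"
      have den: "0 < c * 2 ^ M * (M + 1) + 1"
        using c(1) by (intro add_nonneg_pos mult_nonneg_nonneg) auto
      then have d: "0 < d"
        using e(1) by (simp add: d_def)
      define V where "V = (\<Inter>i\<in>{..M}. (\<lambda>v. v i) -` {y. rapid_seminorm M (y - u i) < d})"
      have "open V"
        unfolding V_def
      proof (intro open_INT ballI)
        fix i
        show "open ((\<lambda>v :: nat \<Rightarrow> 'a rapid_seq. v i) -` {y. rapid_seminorm M (y - u i) < d})"
          using continuous_on_product_coordinates[of i] open_rapid_ball[OF d]
          unfolding continuous_on_open_vimage[OF open_UNIV] Int_UNIV_right by blast
      qed simp
      moreover have "u \<in> V"
        using d by (simp add: V_def rapid_seminorm_zero)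
      moreover have "V \<subseteq> (\<lambda>u. operator \<beta> u k) -` B"
      proof
        fix v assume v: "v \<in> V"
        let ?w = "v - u"
        have "rapid_seminorm N (operator \<beta> v k - operator \<beta> u k) = rapid_seminorm N (operator \<beta> ?w k)"
          by (simp add: operator_diff)
        also have "\<dots> \<le> seminorm \<beta> (max N k) (shift_op (coords \<beta> ?w))"
          using seminorm_le_coords[of N "operator \<beta> ?w" k] by (simp add: coords_operator)
        also have "\<dots> \<le> c * seminorm \<beta> M (coords \<beta> ?w)"
          by (intro c coords_bound)
        also have "\<dots> \<le> c * (2 ^ M * (\<Sum>i\<le>M. rapid_seminorm M (?w i)))"
          by (intro mult_left_mono c coords_bound)
        also have "\<dots> \<le> c * (2 ^ M * (\<Sum>i\<le>M. d))"
          using v c(1) by (intro mult_left_mono sum_mono) (auto simp: V_def less_imp_le)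
        also have "\<dots> = (c * 2 ^ M * (M + 1)) * d"
          by simp
        also have "\<dots> < (c * 2 ^ M * (M + 1) + 1) * d"
          using d by (intro mult_strict_right_mono) auto
        also have "\<dots> = e"
          using den by (simp add: d_def)
        finally show "v \<in> (\<lambda>u. operator \<beta> u k) -` B"
          using e(2) by auto
      qed
      ultimately show "\<exists>V. open V \<and> u \<in> V \<and> V \<subseteq> (\<lambda>u. operator \<beta> u k) -` B"
        by blast
    qed
  qed
qed

text \<open>
  A basic neighbourhood in the product restricts finitely many rows, each by one seminorm of \<open>s\<close>, so a
  single seminorm of the sequence space controls it.
\<close>

lemma closed_coords:
  fixes H :: "(nat \<Rightarrow> 'a::real_normed_field rapid_seq) set"
  assumes H: "closed H" and x: "x \<in> koethe \<beta>"
    and approx: "\<And>N \<epsilon>. 0 < \<epsilon> \<Longrightarrow> \<exists>h\<in>H. seminorm \<beta> N (\<lambda>k. coords \<beta> h k - x k) < \<epsilon>"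
  shows "x \<in> coords \<beta> ` H"
proof -
  define u where "u = of_coords \<beta> x"
  have ux: "coords \<beta> u = x"
    using x by (simp add: u_def coords_of_coords)
  have "u \<in> H"
  proof (rule ccontr)
    assume "u \<notin> H"
    have "openin (product_topology (\<lambda>_. euclidean) UNIV) (- H)"
      using H by (simp add: open_fun_def[symmetric] open_Compl)
    then obtain V where V: "u \<in> Pi\<^sub>E UNIV V" "\<And>i. open (V i)" "finite {i. V i \<noteq> UNIV}"
      "Pi\<^sub>E UNIV V \<subseteq> - H"
      using product_topology_open_contains_basis[of "\<lambda>_. euclidean" UNIV "- H" u] \<open>u \<notin> H\<close> by auto
    let ?I = "{i. V i \<noteq> UNIV}"
    have "\<exists>N e. 0 < e \<and> {y. rapid_seminorm N (y - u i) < e} \<subseteq> V i" for i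
      using open_rapid_contains_ball[OF V(2)[of i], of "u i"] V(1) by (metis PiE_E UNIV_I)
    then obtain N e where Ne: "\<And>i. 0 < e i \<and> {y. rapid_seminorm (N i) (y - u i) < e i} \<subseteq> V i"
      by metis
    define M where "M = (\<Sum>i\<in>?I. N i + i)"
    define d where "d = Min (insert 1 (e ` ?I))"
    have d: "0 < d" "\<And>i. i \<in> ?I \<Longrightarrow> d \<le> e i"
      using V(3) Ne by (auto simp: d_def)
    have M: "max (N i) i \<le> M" if "i \<in> ?I" for i
      using member_le_sum[of i ?I "\<lambda>i. N i + i"] that V(3) by (auto simp: M_def)
    obtain h where h: "h \<in> H" "seminorm \<beta> M (\<lambda>k. coords \<beta> h k - x k) < d"
      using approx[OF d(1)] by blast
    have "h i \<in> V i" for i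
    proof (cases "i \<in> ?I")
      case True
      have "rapid_seminorm (N i) (h i - u i) \<le> seminorm \<beta> (max (N i) i) (coords \<beta> (h - u))"
        using seminorm_le_coords[of "N i" "h - u" i] by simp
      also have "\<dots> \<le> seminorm \<beta> M (coords \<beta> (h - u))"
        by (intro seminorm_mono coords_bound M True)
      also have "\<dots> < d"
        using h(2) by (simp add: coords_minus ux)
      also have "\<dots> \<le> e i"
        by (rule d(2)[OF True])
      finally show ?thesis
        using Ne[of i] by blast
    qed simp
    then have "h \<in> Pi\<^sub>E UNIV V"
      by (simp add: PiE_UNIV_domain)
    then show False
      using V(4) h(1) by blast
  qed
  then show ?thesis
    using ux by blast
qed

end

lemma (in cyclic_weights) operator_no_invariant_subspace:
  "has_no_nontrivial_invariant_subspace (operator \<beta> :: (nat \<Rightarrow> 'a rapid_seq) \<Rightarrow> _)"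
  unfolding has_no_nontrivial_invariant_subspace_def
proof (rule notI, elim exE conjE)
  fix H :: "(nat \<Rightarrow> 'a rapid_seq) set"
  assume H: "closed H" "module.subspace scale_rapid_seq_prod H" "{0} \<subset> H" "H \<subset> UNIV"
    "operator \<beta> ` H \<subseteq> H"
  have add: "u + v \<in> H" if "u \<in> H" "v \<in> H" for u v
    using H(2) that by (simp add: rapid_seq_prod.subspace_def)
  have scale: "scale_rapid_seq_prod a u \<in> H" if "u \<in> H" for a u
    using H(2) that by (simp add: rapid_seq_prod.subspace_def)
  obtain u where u: "u \<in> H" "u \<noteq> 0"
    using H(3) by blast
  have zero: "coords \<beta> (0 :: nat \<Rightarrow> 'a rapid_seq) = (\<lambda>_. 0)"
    by (simp add: coords_def zero_rapid_seq.rep_eq fun_eq_iff)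
  have "coords \<beta> ` H = koethe \<beta>"
  proof (rule no_invariant_subspace)
    show "coords \<beta> ` H \<subseteq> koethe \<beta>"
      using coords_bound by blast
    show "coords \<beta> u \<in> coords \<beta> ` H" using u by blast
    show "coords \<beta> u \<noteq> (\<lambda>_. 0)"
      using u coords_inject[of u 0] zero by metis
    show "(\<lambda>k. x k + y k) \<in> coords \<beta> ` H" if "x \<in> coords \<beta> ` H" "y \<in> coords \<beta> ` H" for x y
      using that add by (auto simp: coords_plus[symmetric])
    show "(\<lambda>k. a * x k) \<in> coords \<beta> ` H" if "x \<in> coords \<beta> ` H" for a x
      using that scale by (auto simp: coords_scale[symmetric])
    show "shift_op x \<in> coords \<beta> ` H" if "x \<in> coords \<beta> ` H" for x
      using that H(5) by (auto simp: coords_operator[symmetric])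
    show "x \<in> coords \<beta> ` H" if "x \<in> koethe \<beta>"
      and "\<And>N \<epsilon>. 0 < \<epsilon> \<Longrightarrow> \<exists>y\<in>coords \<beta> ` H. seminorm \<beta> N (\<lambda>k. y k - x k) < \<epsilon>" for x
      using closed_coords[OF H(1) that(1)] that(2) by blast
  qed
  then have "v \<in> H" for v
    using coords_bound(1)[of v] coords_inject by (metis imageE)
  then show False
    using H(4) by blast
qed

lemma operator_exists:
  "\<exists>T :: (nat \<Rightarrow> 'a::{real_normed_field, banach, heine_borel} rapid_seq) \<Rightarrow> (nat \<Rightarrow> 'a rapid_seq).
     Vector_Spaces.linear scale_rapid_seq_prod scale_rapid_seq_prod T \<and>
     continuous_on UNIV T \<and> has_no_nontrivial_invariant_subspace T"
proof -
  obtain \<beta> where "\<And>n. large_at \<beta> n (\<beta> n)" "\<And>m. uniformly_solvable TYPE('a) \<beta> m (\<beta> (Suc m))"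
    using weights_exist[where 'a='a] by blast
  then interpret cyclic_weights \<beta> "TYPE('a)"
    by unfold_locales
  show ?thesis
    using operator_linear operator_continuous operator_no_invariant_subspace by blast
qed

theorem mainTheorem1:
  shows "(\<exists>T :: (nat \<Rightarrow> real rapid_seq) \<Rightarrow> (nat \<Rightarrow> real rapid_seq).
            Vector_Spaces.linear scale_rapid_seq_prod scale_rapid_seq_prod T \<and>
            continuous_on UNIV T \<and> has_no_nontrivial_invariant_subspace T)
       \<and> (\<exists>T :: (nat \<Rightarrow> complex rapid_seq) \<Rightarrow> (nat \<Rightarrow> complex rapid_seq).
            Vector_Spaces.linear scale_rapid_seq_prod scale_rapid_seq_prod T \<and>
            continuous_on UNIV T \<and> has_no_nontrivial_invariant_subspace T)"
  using operator_exists[where 'a=real] operator_exists[where 'a=complex] by blast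

end
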